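(* Let $(\mathcal{S},\mathcal{A},\mathcal{P},r)$ be a weakly communicating average reward MDP, let $Q^*$ be any solution of Bellman's equation $Q^*=\mathcal{T}(Q^* )-g^*$, let $Q^0\in\mathbb{R}^{\mathcal{S}\times\mathcal{A}}$, $\varepsilon>0$, $\delta\in(0,1)$, and set $\mu=\|Q^0-Q^*\|_{\mathrm{sp}}$ and $\nu=\|Q^0-Q^*\|_{\mathrm{sp}}+\|Q^0\|_{\mathrm{sp}}$. Let $(Q^N,T^N,\pi^N)$ be the output of $\mathrm{SAVIA}\textbf{+}(Q^0,\varepsilon,\delta)$ run with $c_k=5(k+2)\ln^2(k+2)$ and $\beta_k=k/(k+2)$. Then, with probability at least $1-\delta$, we have for all $s\in\mathcal{S}$ $$g^*-g_{\pi^N}(s)\le\|Q^N-\mathcal{T}(Q^N)\|_{\mathrm{sp}}\le16\,\varepsilon,$$ with sample and time complexity $$O\big(\widehat{L}\,|\mathcal{S}||\mathcal{A}|\,(\nu^2/\varepsilon^2+1)\big),\qquad \widehat{L}=\ln\!\big(|\mathcal{S}||\mathcal{A}|(1+\mu/\varepsilon)/\delta\big)\,\ln^4(1+\mu/\varepsilon).$$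
   Context: An average reward MDP $(\mathcal{S},\mathcal{A},\mathcal{P},r)$ has finite state space $\mathcal{S}$, finite action space $\mathcal{A}$, transition kernel $\mathcal{P}$ (each $\mathcal{P}(\cdot|s,a)$ is a probability distribution on $\mathcal{S}$) and reward $r:\mathcal{S}\times\mathcal{A}\to\mathbb{R}$. A policy is a map $\pi:\mathcal{S}\to\mathcal{A}$, with gain $g_\pi(s)=\lim_{n\to\infty}\mathbb{E}_\pi\big[\frac1n\sum_{t=0}^{n-1}r(s_t,a_t)|s_0=s\big]$, where $a_t=\pi(s_t)$, $s_{t+1}\sim\mathcal{P}(\cdot|s_t,a_t)$. The optimal gain is $g^*(s)=\max_\pi g_\pi(s)$. The MDP is weakly communicating if there is a set of states such that each state of the set is accessible from every other state of the set under some policy, and all remaining states (possibly none) are transient under every policy; then $g^*(s)\equiv g^*\in\mathbb{R}$ is constant. Notation: $\|x\|_{\mathrm{sp}}=\max_jx(j)-\min_jx(j)$. $\max_{\mathcal{A}}(Q)(s)=\max_{a}Q(s,a)$. $\mathcal{T}(Q)(s,a)=r(s,a)+\sum_{s'}\mathcal{P}(s'|s,a)\max_{\mathcal{A}}(Q)(s')$. The Bellman equation $Q=\mathcal{T}(Q)-g^*$ always has solutions. $O(\cdot)$ hides an absolute constant factor. Subroutine $\mathrm{SAMPLE}(d,m)$, $d\in\mathbb{R}^{\mathcal{S}}$, $m\ge1$ integer: for each $(s,a)$ draw $m$ fresh i.i.d. samples $s_1,\dots,s_m\sim\mathcal{P}(\cdot|s,a)$ (independent of the past) and return the matrix $D(s,a)=\frac1m\sum_{j=1}^m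 d(s_j)$. It uses $|\mathcal{S}||\mathcal{A}|m$ samples. Algorithm $\mathrm{SAVIA}(Q^0,n,\varepsilon,\delta)$ (with sequences $c_k,\beta_k$): set $\alpha=\ln(2|\mathcal{S}||\mathcal{A}|(n+1)/\delta)$, $T^{-1}=r$, $h^{-1}=0$, $\beta_0=0$. For $k=0,\dots,n$: $Q^k=(1-\beta_k)Q^0+\beta_kT^{k-1}$; $h^k=\max_{\mathcal{A}}(Q^k)$; $d^k=h^k-h^{k-1}$; $m_k=\max\{\lceil\alpha c_k\|d^k\|_{\mathrm{sp}}^2/\varepsilon^2\rceil,1\}$; $D^k=\mathrm{SAMPLE}(d^k,m_k)$; $T^k=T^{k-1}+D^k$. Finally choose $\pi^n(s)\in\operatorname{argmax}_aQ^n(s,a)$ and output $(Q^n,T^n,\pi^n)$. Algorithm $\mathrm{SAVIA}\textbf{+}(Q^0,\varepsilon,\delta)$: for $i=0,1,2,\dots$ set $n_i=2^i$, $\delta_i=\delta/c_i$, and run $\mathrm{SAVIA}(Q^0,n_i,\varepsilon,\delta_i)$ afresh (with samples independent of earlier loops) to get $(Q^{n_i},T^{n_i},\pi^{n_i})$; stop at the first $i$ with $\|Q^{n_i}-T^{n_i}\|_{\mathrm{sp}}\le14\varepsilon$ and output $(Q^{n_i},T^{n_i},\pi^{n_i})$, denoted $(Q^N,T^N,\pi^N)$ with $N=n_i$ for this $i$. Sample complexity is the total number of samples drawn over all loops until stopping; time complexity is the running time under the convention that each sample costs $O(1)$ time, so that it is of the same order as the sample complexity.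
   Formalization: Each logarithm in L-hat is replaced by its maximum with 1, since for mu = 0 the stated bound is 0 although every run draws at least 2|S||A| samples; finite state and action spaces are encoded as finite sets of natural numbers. *)

theory Defs
  imports "HOL-Probability.Probability"
begin

section \<open>Average reward MDPs\<close>

record ('s, 'a) mdp =
  states :: "'s set"
  actions :: "'a set"
  kernel :: "'s \<times> 'a \<Rightarrow> 's pmf"
  reward :: "'s \<times> 'a \<Rightarrow> real"

abbreviation sa_pairs :: "('s, 'a) mdp \<Rightarrow> ('s \<times> 'a) set" where
  "sa_pairs M \<equiv> states M \<times> actions M"

definition finite_mdp :: "('s, 'a) mdp \<Rightarrow> bool" where
  "finite_mdp M \<longleftrightarrow>
     finite (states M) \<and> states M \<noteq> {} \<and> finite (actions M) \<and> actions M \<noteq> {} \<and>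
     (\<forall>x \<in> sa_pairs M. set_pmf (kernel M x) \<subseteq> states M)"

definition policies :: "('s, 'a) mdp \<Rightarrow> ('s \<Rightarrow> 'a) set" where
  "policies M = states M \<rightarrow>\<^sub>E actions M"

text \<open>Law of the first \<open>n\<close> states \<open>[s\<^sub>0, \<dots>, s\<^sub>n\<^sub>-\<^sub>1]\<close> visited under \<open>\<pi>\<close> when \<open>s\<^sub>0 = s\<close>.\<close>

primrec path_pmf :: "('s, 'a) mdp \<Rightarrow> ('s \<Rightarrow> 'a) \<Rightarrow> nat \<Rightarrow> 's \<Rightarrow> 's list pmf" where
  "path_pmf M \<pi> 0 s = return_pmf []"
| "path_pmf M \<pi> (Suc n) s =
     bind_pmf (kernel M (s, \<pi> s)) (\<lambda>s'. map_pmf (\<lambda>ss. s # ss) (path_pmf M \<pi> n s'))"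

definition gain :: "('s, 'a) mdp \<Rightarrow> ('s \<Rightarrow> 'a) \<Rightarrow> 's \<Rightarrow> real" where
  "gain M \<pi> s = lim (\<lambda>n. measure_pmf.expectation (path_pmf M \<pi> n s)
     (\<lambda>ss. 1 / real n * (\<Sum>t<n. reward M (ss ! t, \<pi> (ss ! t)))))"

definition opt_gain_at :: "('s, 'a) mdp \<Rightarrow> 's \<Rightarrow> real" where
  "opt_gain_at M s = Max ((\<lambda>\<pi>. gain M \<pi> s) ` policies M)"

text \<open>The scalar \<open>g\<^sup>*\<close>: the common value of the optimal gain, which is the same at all
  states when the MDP is weakly communicating.\<close>

definition opt_gain :: "('s, 'a) mdp \<Rightarrow> real" where
  "opt_gain M = (THE g. \<forall>s \<in> states M. opt_gain_at M s = g)"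

definition accessible :: "('s, 'a) mdp \<Rightarrow> ('s \<Rightarrow> 'a) \<Rightarrow> 's \<Rightarrow> 's \<Rightarrow> bool" where
  "accessible M \<pi> s s' \<longleftrightarrow>
     (\<exists>n. measure_pmf.prob (path_pmf M \<pi> (Suc n) s) {ss. last ss = s'} > 0)"

text \<open>The probabilities below are those of returning to \<open>s\<close> within \<open>n\<close> steps; they increase
  with \<open>n\<close> to the probability of ever returning.\<close>

definition transient :: "('s, 'a) mdp \<Rightarrow> ('s \<Rightarrow> 'a) \<Rightarrow> 's \<Rightarrow> bool" where
  "transient M \<pi> s \<longleftrightarrow>
     (SUP n. measure_pmf.prob (path_pmf M \<pi> (Suc n) s) {ss. s \<in> set (tl ss)}) < 1"

definition weakly_communicating :: "('s, 'a) mdp \<Rightarrow> bool" where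
  "weakly_communicating M \<longleftrightarrow>
     (\<exists>C \<subseteq> states M.
        (\<forall>s \<in> C. \<forall>s' \<in> C. s \<noteq> s' \<longrightarrow> (\<exists>\<pi> \<in> policies M. accessible M \<pi> s s')) \<and>
        (\<forall>s \<in> states M - C. \<forall>\<pi> \<in> policies M. transient M \<pi> s))"

definition sp :: "'i set \<Rightarrow> ('i \<Rightarrow> real) \<Rightarrow> real" where
  "sp I x = Max (x ` I) - Min (x ` I)"

definition max_act :: "('s, 'a) mdp \<Rightarrow> ('s \<times> 'a \<Rightarrow> real) \<Rightarrow> 's \<Rightarrow> real" where
  "max_act M Q s = Max ((\<lambda>a. Q (s, a)) ` actions M)"

definition bellman :: "('s, 'a) mdp \<Rightarrow> ('s \<times> 'a \<Rightarrow> real) \<Rightarrow> 's \<times> 'a \<Rightarrow> real" where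
  "bellman M Q x = reward M x + (\<Sum>s' \<in> states M. pmf (kernel M x) s' * max_act M Q s')"

definition bellman_solution :: "('s, 'a) mdp \<Rightarrow> ('s \<times> 'a \<Rightarrow> real) \<Rightarrow> bool" where
  "bellman_solution M Q \<longleftrightarrow> (\<forall>x \<in> sa_pairs M. Q x = bellman M Q x - opt_gain M)"

definition greedy :: "('s, 'a) mdp \<Rightarrow> ('s \<times> 'a \<Rightarrow> real) \<Rightarrow> ('s \<Rightarrow> 'a) set" where
  "greedy M Q = {\<pi> \<in> policies M. \<forall>s \<in> states M. is_arg_max (\<lambda>a. Q (s, a)) (\<lambda>a. a \<in> actions M) (\<pi> s)}"


section \<open>The algorithms\<close>

definition SAMPLE :: "('s, 'a) mdp \<Rightarrow> ('s \<Rightarrow> real) \<Rightarrow> nat \<Rightarrow> ('s \<times> 'a \<Rightarrow> real) pmf" where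
  "SAMPLE M d m = Pi_pmf (sa_pairs M) 0
     (\<lambda>x. map_pmf (\<lambda>ss. 1 / real m * (\<Sum>j<m. d (ss ! j))) (replicate_pmf m (kernel M x)))"

text \<open>A configuration \<open>(Q, T, h, N, W)\<close> holds \<open>Q\<^sup>k\<close>, \<open>T\<^sup>k\<close>, \<open>h\<^sup>k\<close>, the number \<open>N\<close> of samples drawn
  so far and the running time \<open>W\<close> so far. The latter charges one unit per sample, and one unit
  per entry of the state-action table for the remaining arithmetic of an iteration, which makes
  a bounded number of passes over tables of that size.\<close>

type_synonym ('s, 'a) config =
  "('s \<times> 'a \<Rightarrow> real) \<times> ('s \<times> 'a \<Rightarrow> real) \<times> ('s \<Rightarrow> real) \<times> nat \<times> nat"

definition savia_step ::
  "('s, 'a) mdp \<Rightarrow> (nat \<Rightarrow> real) \<Rightarrow> (nat \<Rightarrow> real) \<Rightarrow> ('s \<times> 'a \<Rightarrow> real) \<Rightarrow> real \<Rightarrow> real \<Rightarrow> nat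
     \<Rightarrow> ('s, 'a) config \<Rightarrow> ('s, 'a) config pmf" where
  "savia_step M c \<beta> Q0 \<epsilon> \<alpha> k = (\<lambda>(_, T, h, N, W).
     let Q' = (\<lambda>x. (1 - \<beta> k) * Q0 x + \<beta> k * T x);
         h' = max_act M Q';
         d = (\<lambda>s. h' s - h s);
         m = max (nat \<lceil>\<alpha> * c k * (sp (states M) d)\<^sup>2 / \<epsilon>\<^sup>2\<rceil>) 1;
         e = card (states M) * card (actions M)
     in map_pmf (\<lambda>D. (Q', \<lambda>x. T x + D x, h', N + e * m, W + e * m + e)) (SAMPLE M d m))"

text \<open>The configuration after the iterations \<open>0, \<dots>, k - 1\<close>; the initial \<open>Q\<close>-component is never read.\<close>

primrec savia_iter ::
  "('s, 'a) mdp \<Rightarrow> (nat \<Rightarrow> real) \<Rightarrow> (nat \<Rightarrow> real) \<Rightarrow> ('s \<times> 'a \<Rightarrow> real) \<Rightarrow> real \<Rightarrow> real \<Rightarrow> nat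
     \<Rightarrow> ('s, 'a) config pmf" where
  "savia_iter M c \<beta> Q0 \<epsilon> \<alpha> 0 = return_pmf (Q0, reward M, \<lambda>_. 0, 0, 0)"
| "savia_iter M c \<beta> Q0 \<epsilon> \<alpha> (Suc k) =
     bind_pmf (savia_iter M c \<beta> Q0 \<epsilon> \<alpha> k) (savia_step M c \<beta> Q0 \<epsilon> \<alpha> k)"

type_synonym ('s, 'a) result =
  "('s \<times> 'a \<Rightarrow> real) \<times> ('s \<times> 'a \<Rightarrow> real) \<times> ('s \<Rightarrow> 'a) \<times> nat \<times> nat"

text \<open>\<open>\<beta> 0\<close> is reset to \<open>0\<close> as the algorithm prescribes. \<open>sel\<close> is the tie-breaking rule that
  picks a greedy policy. The last component of the result charges one more pass over the table
  for extracting that policy and evaluating the stopping test of SAVIA+.\<close>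

definition SAVIA ::
  "('s, 'a) mdp \<Rightarrow> (nat \<Rightarrow> real) \<Rightarrow> (nat \<Rightarrow> real) \<Rightarrow> (('s \<times> 'a \<Rightarrow> real) \<Rightarrow> 's \<Rightarrow> 'a)
     \<Rightarrow> ('s \<times> 'a \<Rightarrow> real) \<Rightarrow> nat \<Rightarrow> real \<Rightarrow> real \<Rightarrow> ('s, 'a) result pmf" where
  "SAVIA M c \<beta> sel Q0 n \<epsilon> \<delta> =
     (let e = card (states M) * card (actions M);
          \<alpha> = ln (2 * real e * (real n + 1) / \<delta>)
      in map_pmf (\<lambda>(Q, T, h, N, W). (Q, T, sel Q, N, W + e))
           (savia_iter M c (\<beta>(0 := 0)) Q0 \<epsilon> \<alpha> (Suc n)))"

text \<open>Loops \<open>i, i + 1, \<dots>\<close> of SAVIA+, entered with \<open>N\<close> samples drawn and \<open>W\<close> units of time spent.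
  This is a sub-probability distribution: runs that never stop have no outcome.\<close>

partial_function (spmf) savia_plus_from ::
  "('s, 'a) mdp \<Rightarrow> (nat \<Rightarrow> real) \<Rightarrow> (nat \<Rightarrow> real) \<Rightarrow> (('s \<times> 'a \<Rightarrow> real) \<Rightarrow> 's \<Rightarrow> 'a)
     \<Rightarrow> ('s \<times> 'a \<Rightarrow> real) \<Rightarrow> real \<Rightarrow> real \<Rightarrow> nat \<Rightarrow> nat \<Rightarrow> nat \<Rightarrow> ('s, 'a) result spmf" where
  "savia_plus_from M c \<beta> sel Q0 \<epsilon> \<delta> i N W =
     bind_pmf (SAVIA M c \<beta> sel Q0 (2 ^ i) \<epsilon> (\<delta> / c i)) (\<lambda>(Q, T, \<pi>, N', W').
       if sp (sa_pairs M) (\<lambda>x. Q x - T x) \<le> 14 * \<epsilon>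
       then return_spmf (Q, T, \<pi>, N + N', W + W')
       else savia_plus_from M c \<beta> sel Q0 \<epsilon> \<delta> (Suc i) (N + N') (W + W'))"

definition SAVIA_plus ::
  "('s, 'a) mdp \<Rightarrow> (nat \<Rightarrow> real) \<Rightarrow> (nat \<Rightarrow> real) \<Rightarrow> (('s \<times> 'a \<Rightarrow> real) \<Rightarrow> 's \<Rightarrow> 'a)
     \<Rightarrow> ('s \<times> 'a \<Rightarrow> real) \<Rightarrow> real \<Rightarrow> real \<Rightarrow> ('s, 'a) result spmf" where
  "SAVIA_plus M c \<beta> sel Q0 \<epsilon> \<delta> = savia_plus_from M c \<beta> sel Q0 \<epsilon> \<delta> 0 0 0"

text \<open>In complexity bounds a logarithm stands for its maximum with \<open>1\<close>: as \<open>\<mu>/\<epsilon> \<rightarrow> 0\<close> the factor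
  \<open>ln (1 + \<mu>/\<epsilon>)\<close> vanishes, although a run always draws at least two samples per
  state-action pair. For \<open>\<mu>/\<epsilon> \<ge> e - 1\<close> both logarithms of \<open>L_hat\<close> are at least \<open>1\<close> and the
  maxima have no effect.\<close>

definition ln1 :: "real \<Rightarrow> real" where
  "ln1 x = max 1 (ln x)"

definition L_hat :: "('s, 'a) mdp \<Rightarrow> real \<Rightarrow> real \<Rightarrow> real \<Rightarrow> real" where
  "L_hat M \<mu> \<epsilon> \<delta> =
     ln1 (real (card (states M)) * real (card (actions M)) * (1 + \<mu> / \<epsilon>) / \<delta>) *
     ln1 (1 + \<mu> / \<epsilon>) ^ 4"

text \<open>An absolute constant must not depend on the sizes of the state and action spaces. It would,
  if these were types or carriers in types left as variables; statements about absolute constants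
  therefore range over MDPs of type \<open>(nat, nat) mdp\<close>, which cover all finite sizes.\<close>

end

theory Submission
  imports Defs
begin

text \<open>A solution of Bellman's equation with constant \<open>g\<^sup>*\<close> makes every greedy policy for it optimal, and
  iterating the Bellman residual along a policy shows that a greedy policy for \<open>Q\<close> loses at most the
  span of \<open>Q - \<T>(Q)\<close>. The errors \<open>T\<^sup>k - \<T>(Q\<^sup>k)\<close> are martingales; by Hoeffding's lemma and
  \<open>\<Sum> 1/c\<^sub>k \<le> 1\<close> the sample sizes keep all of them below \<open>\<epsilon>\<close> with the required probability.
  On that event induction over the anchored iteration gives \<open>\<parallel>Q\<^sup>k - Q\<^sup>*\<parallel> \<le> \<mu> + 2\<epsilon>k/3\<close> and
  \<open>\<parallel>Q\<^sup>k - Q\<^sup>k\<^sup>-\<^sup>1\<parallel> \<le> 4\<mu>/(k + 1) + 2\<epsilon>/3\<close> in span, where the second bound uses that averages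
  of samples of \<open>d\<close> never have larger span than \<open>d\<close>. Hence \<open>\<parallel>Q\<^sup>n - T\<^sup>n\<parallel> \<le> 8\<mu>/(n + 2) + 3\<epsilon>\<close>, and the
  restarts stop as soon as \<open>2\<^sup>i \<ge> \<mu>/\<epsilon>\<close>, after \<open>O(ln (1 + \<mu>/\<epsilon>))\<close> loops.\<close>

section \<open>The span seminorm\<close>

text \<open>Two obstacles shape the estimates. The sample size \<open>m\<^sub>k\<close> depends on
  \<open>d\<^sup>k\<close> and so on the past; it is chosen so that, given the past, iteration
  \<open>k\<close> adds to the logarithm of the exponential moment at most a deterministic amount
  proportional to \<open>1 / c\<^sub>k\<close>. Moreover the distance of \<open>Q\<^sup>k\<close>
  from \<open>Q\<^sup>*\<close> may drift linearly in \<open>k\<close>. This is harmless because the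
  drift enters \<open>Q\<^sup>n - T\<^sup>n\<close> with the weight
  \<open>1 - \<beta>\<^sub>n = 2 / (n + 2)\<close>, and
  \<open>Q\<^sup>k\<^sup>+\<^sup>1 - Q\<^sup>k\<close> with the weight
  \<open>\<beta>\<^sub>k\<^sub>+\<^sub>1 - \<beta>\<^sub>k\<close>, which is of order
  \<open>1 / k\<^sup>2\<close>. The sequence \<open>c\<close> does double duty: the sum of its
  reciprocals bounds the exponent within one run and the total failure probability over the
  restarts. The logarithms of \<open>L_hat\<close> have separate origins: the first is
  \<open>\<alpha>\<close>; of the other four, two come from the square in \<open>c\<^sub>k\<close>,
  one from a harmonic sum over \<open>k\<close>, and one from the number of loops.\<close>

lemma sp_le_iff:
  assumes "finite I" "I \<noteq> {}"
  shows "sp I x \<le> c \<longleftrightarrow> (\<forall>i\<in>I. \<forall>j\<in>I. x i - x j \<le> c)"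
proof
  assume le: "sp I x \<le> c"
  show "\<forall>i\<in>I. \<forall>j\<in>I. x i - x j \<le> c"
  proof (intro ballI)
    fix i j assume "i \<in> I" "j \<in> I"
    then have "x i \<le> Max (x ` I)" "Min (x ` I) \<le> x j"
      using assms by auto
    with le show "x i - x j \<le> c" by (simp add: sp_def)
  qed
next
  assume le: "\<forall>i\<in>I. \<forall>j\<in>I. x i - x j \<le> c"
  have "Max (x ` I) \<in> x ` I" "Min (x ` I) \<in> x ` I"
    using assms by auto
  with le show "sp I x \<le> c" by (auto simp: sp_def)
qed

lemma diff_le_sp: "finite I \<Longrightarrow> i \<in> I \<Longrightarrow> j \<in> I \<Longrightarrow> x i - x j \<le> sp I x"
  using sp_le_iff[of I x "sp I x"] by blast

lemma sp_nonneg: "finite I \<Longrightarrow> I \<noteq> {} \<Longrightarrow> 0 \<le> sp I x"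
proof -
  assume "finite I" "I \<noteq> {}"
  moreover from this obtain i where "i \<in> I" by blast
  ultimately show ?thesis using diff_le_sp[of I i i x] by simp
qed

lemma sp_cong: "(\<And>i. i \<in> I \<Longrightarrow> x i = y i) \<Longrightarrow> sp I x = sp I y"
  unfolding sp_def by (metis image_cong)

lemma sp_add_le:
  assumes "finite I" "I \<noteq> {}"
  shows "sp I (\<lambda>i. x i + y i) \<le> sp I x + sp I y"
  unfolding sp_le_iff[OF assms]
proof (intro ballI)
  fix i j assume "i \<in> I" "j \<in> I"
  then show "x i + y i - (x j + y j) \<le> sp I x + sp I y"
    using diff_le_sp[of I i j x] diff_le_sp[of I i j y] assms by linarith
qed

lemma sp_minus:
  assumes "finite I" "I \<noteq> {}"
  shows "sp I (\<lambda>i. - x i) = sp I x"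
proof (rule antisym)
  show "sp I (\<lambda>i. - x i) \<le> sp I x"
    unfolding sp_le_iff[OF assms]
  proof (intro ballI)
    fix i j assume "i \<in> I" "j \<in> I"
    then show "- x i - - x j \<le> sp I x"
      using diff_le_sp[of I j i x] assms by simp
  qed
  show "sp I x \<le> sp I (\<lambda>i. - x i)"
    unfolding sp_le_iff[OF assms]
  proof (intro ballI)
    fix i j assume "i \<in> I" "j \<in> I"
    then show "x i - x j \<le> sp I (\<lambda>i. - x i)"
      using diff_le_sp[of I j i "\<lambda>i. - x i"] assms by simp
  qed
qed

lemma sp_diff_le:
  assumes "finite I" "I \<noteq> {}"
  shows "sp I (\<lambda>i. x i - y i) \<le> sp I x + sp I y"
  using sp_add_le[OF assms, of x "\<lambda>i. - y i"] sp_minus[OF assms, of y] by simp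

lemma sp_add_const_le:
  assumes "finite I" "I \<noteq> {}"
  shows "sp I (\<lambda>i. x i + c) \<le> sp I x"
  unfolding sp_le_iff[OF assms] using diff_le_sp[OF assms(1), of _ _ x] by simp

lemma sp_scale_le:
  assumes "finite I" "I \<noteq> {}" "0 \<le> c"
  shows "sp I (\<lambda>i. c * x i) \<le> c * sp I x"
  unfolding sp_le_iff[OF assms(1,2)]
proof (intro ballI)
  fix i j assume "i \<in> I" "j \<in> I"
  then have "c * (x i - x j) \<le> c * sp I x"
    using diff_le_sp[of I i j x] assms by (intro mult_left_mono) auto
  then show "c * x i - c * x j \<le> c * sp I x" by (simp add: algebra_simps)
qed

lemma sp_le_abs_bound:
  assumes "finite I" "I \<noteq> {}" "\<And>i. i \<in> I \<Longrightarrow> \<bar>x i\<bar> \<le> c"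
  shows "sp I x \<le> 2 * c"
  unfolding sp_le_iff[OF assms(1,2)]
  by (smt (verit) assms(3))

section \<open>Averaging with respect to the transition kernel\<close>

text \<open>A finite sum rather than an integral, so that linearity holds for every argument without
  integrability conditions.\<close>

definition kernel_mean :: "('s, 'a) mdp \<Rightarrow> 's \<times> 'a \<Rightarrow> ('s \<Rightarrow> real) \<Rightarrow> real" where
  "kernel_mean M x f = (\<Sum>s'\<in>states M. pmf (kernel M x) s' * f s')"

lemma bellman_eq: "bellman M Q x = reward M x + kernel_mean M x (max_act M Q)"
  by (simp add: bellman_def kernel_mean_def)

lemma kernel_mean_add: "kernel_mean M x (\<lambda>s. f s + g s) = kernel_mean M x f + kernel_mean M x g"
  by (simp add: kernel_mean_def algebra_simps sum.distrib)

lemma kernel_mean_diff: "kernel_mean M x (\<lambda>s. f s - g s) = kernel_mean M x f - kernel_mean M x g"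
  by (simp add: kernel_mean_def algebra_simps sum_subtractf)

lemma kernel_mean_scale: "kernel_mean M x (\<lambda>s. c * f s) = c * kernel_mean M x f"
  by (simp add: kernel_mean_def algebra_simps sum_distrib_left)

lemma kernel_mean_sum:
  "kernel_mean M x (\<lambda>s. \<Sum>i\<in>A. f i s) = (\<Sum>i\<in>A. kernel_mean M x (f i))"
  unfolding kernel_mean_def sum_distrib_left by (rule sum.swap)

locale wf_mdp =
  fixes M :: "('s, 'a) mdp"
  assumes finite_mdp: "finite_mdp M"
begin

lemma finite_states: "finite (states M)" and states_nonempty: "states M \<noteq> {}"
  and finite_actions: "finite (actions M)" and actions_nonempty: "actions M \<noteq> {}"
  and finite_pairs: "finite (sa_pairs M)" and pairs_nonempty: "sa_pairs M \<noteq> {}"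
  using finite_mdp by (auto simp: finite_mdp_def)

lemma set_kernel: "x \<in> sa_pairs M \<Longrightarrow> set_pmf (kernel M x) \<subseteq> states M"
  using finite_mdp unfolding finite_mdp_def by blast

lemma kernel_mean_eq_expectation:
  "x \<in> sa_pairs M \<Longrightarrow> kernel_mean M x f = measure_pmf.expectation (kernel M x) f"
  unfolding kernel_mean_def
  by (subst integral_measure_pmf[OF finite_states]) (use set_kernel in auto)

lemma kernel_mean_const: "x \<in> sa_pairs M \<Longrightarrow> kernel_mean M x (\<lambda>_. c) = c"
  by (simp add: kernel_mean_eq_expectation)

lemma kernel_mean_mono:
  "(\<And>s. s \<in> states M \<Longrightarrow> f s \<le> g s) \<Longrightarrow> kernel_mean M x f \<le> kernel_mean M x g"
  unfolding kernel_mean_def by (intro sum_mono mult_left_mono) auto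

lemma kernel_mean_abs_le:
  assumes "x \<in> sa_pairs M" "\<And>s. s \<in> states M \<Longrightarrow> \<bar>f s\<bar> \<le> c"
  shows "\<bar>kernel_mean M x f\<bar> \<le> c"
proof -
  have "kernel_mean M x (\<lambda>_. - c) \<le> kernel_mean M x f" "kernel_mean M x f \<le> kernel_mean M x (\<lambda>_. c)"
    by (intro kernel_mean_mono; use assms(2) in force)+
  with assms(1) show ?thesis by (simp add: kernel_mean_const)
qed

text \<open>All averages lie between the extreme values of \<open>f\<close>, also when two different
  pairs are compared; this carries span bounds from states to pairs.\<close>

lemma sp_kernel_mean_le: "sp (sa_pairs M) (\<lambda>x. kernel_mean M x f) \<le> sp (states M) f"
  unfolding sp_le_iff[OF finite_pairs pairs_nonempty]
proof (intro ballI)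
  fix x y assume xy: "x \<in> sa_pairs M" "y \<in> sa_pairs M"
  have "kernel_mean M x f \<le> kernel_mean M x (\<lambda>_. Max (f ` states M))"
    "kernel_mean M y (\<lambda>_. Min (f ` states M)) \<le> kernel_mean M y f"
    by (intro kernel_mean_mono; use finite_states in force)+
  with xy show "kernel_mean M x f - kernel_mean M y f \<le> sp (states M) f"
    by (simp add: kernel_mean_const sp_def)
qed

lemma max_act_attained:
  obtains a where "a \<in> actions M" "max_act M Q s = Q (s, a)"
proof -
  have "max_act M Q s \<in> (\<lambda>a. Q (s, a)) ` actions M"
    unfolding max_act_def using finite_actions actions_nonempty by (intro Max_in) auto
  then show thesis using that by auto
qed

lemma max_act_ge: "a \<in> actions M \<Longrightarrow> Q (s, a) \<le> max_act M Q s"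
  unfolding max_act_def using finite_actions by auto

text \<open>Take a maximiser of \<open>Q\<close> at \<open>s\<close> and one of \<open>R\<close> at
  \<open>s'\<close>. Each is at best suboptimal for the other table, and both defects have the
  favourable sign.\<close>

lemma sp_max_act_diff_le:
  "sp (states M) (\<lambda>s. max_act M Q s - max_act M R s) \<le> sp (sa_pairs M) (\<lambda>x. Q x - R x)"
  unfolding sp_le_iff[OF finite_states states_nonempty]
proof (intro ballI)
  fix s s' assume s: "s \<in> states M" "s' \<in> states M"
  obtain a where a: "a \<in> actions M" "max_act M Q s = Q (s, a)" by (rule max_act_attained)
  obtain b where b: "b \<in> actions M" "max_act M R s' = R (s', b)" by (rule max_act_attained)
  have "(Q (s, a) - R (s, a)) - (Q (s', b) - R (s', b)) \<le> sp (sa_pairs M) (\<lambda>x. Q x - R x)"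
    using diff_le_sp[OF finite_pairs, of "(s, a)" "(s', b)" "\<lambda>x. Q x - R x"] s a b by simp
  then show "max_act M Q s - max_act M R s - (max_act M Q s' - max_act M R s')
      \<le> sp (sa_pairs M) (\<lambda>x. Q x - R x)"
    using max_act_ge[OF a(1), of R s] max_act_ge[OF b(1), of Q s'] a(2) b(2) by linarith
qed

lemma sp_max_act_le: "sp (states M) (max_act M Q) \<le> sp (sa_pairs M) Q"
proof -
  have "max_act M (\<lambda>_. 0) = (\<lambda>_. 0)"
    using actions_nonempty by (intro ext) (simp add: max_act_def image_constant_conv)
  then show ?thesis using sp_max_act_diff_le[of Q "\<lambda>_. 0"] by simp
qed

lemma sp_bellman_diff_le:
  "sp (sa_pairs M) (\<lambda>x. bellman M Q x - bellman M R x) \<le> sp (sa_pairs M) (\<lambda>x. Q x - R x)"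
proof -
  have "(\<lambda>x. bellman M Q x - bellman M R x)
      = (\<lambda>x. kernel_mean M x (\<lambda>s. max_act M Q s - max_act M R s))"
    by (simp only: bellman_eq kernel_mean_diff add_diff_add diff_self add_0)
  then show ?thesis
    using order_trans[OF sp_kernel_mean_le sp_max_act_diff_le, of Q R] by simp
qed


end


section \<open>The gain of a policy\<close>

text \<open>Bolzano-Weierstrass, refining the subsequence one coordinate at a time.\<close>

lemma finite_convergent_subsequence:
  fixes a :: "nat \<Rightarrow> 'i \<Rightarrow> real"
  assumes "finite S" "\<And>s n. s \<in> S \<Longrightarrow> \<bar>a n s\<bar> \<le> R"
  obtains \<phi> f where "strict_mono \<phi>" "\<And>s. s \<in> S \<Longrightarrow> (\<lambda>n. a (\<phi> n) s) \<longlonglongrightarrow> f s"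
proof -
  have "\<exists>\<phi> f. strict_mono \<phi> \<and> (\<forall>s\<in>S. (\<lambda>n. a (\<phi> n) s) \<longlonglongrightarrow> f s)"
    using assms
  proof (induction S)
    case empty
    show ?case using strict_mono_id by auto
  next
    case (insert i S)
    then obtain \<phi> f where \<phi>: "strict_mono \<phi>" "\<forall>s\<in>S. (\<lambda>n. a (\<phi> n) s) \<longlonglongrightarrow> f s"
      by (metis insertI2)
    have "bounded (range (\<lambda>n. a (\<phi> n) i))"
      using insert.prems[of i] unfolding bounded_iff by (auto intro!: exI[of _ R])
    then obtain l r where r: "strict_mono r" "((\<lambda>n. a (\<phi> n) i) \<circ> r) \<longlonglongrightarrow> l"
      using bounded_imp_convergent_subsequence by blast
    have "(\<lambda>n. a ((\<phi> \<circ> r) n) s) \<longlonglongrightarrow> (f(i := l)) s" if "s \<in> insert i S" for s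
    proof (cases "s = i")
      case False
      then have "(\<lambda>n. a (\<phi> n) s) \<longlonglongrightarrow> f s" using \<phi>(2) that by blast
      from LIMSEQ_subseq_LIMSEQ[OF this r(1)] False show ?thesis by (simp add: comp_def)
    qed (use r(2) in \<open>simp add: comp_def\<close>)
    then show ?case using strict_mono_o[OF \<phi>(1) r(1)] by blast
  qed
  then show thesis using that by blast
qed

context wf_mdp
begin

definition total_reward :: "('s \<Rightarrow> 'a) \<Rightarrow> nat \<Rightarrow> 's \<Rightarrow> real" where
  "total_reward \<pi> n s = measure_pmf.expectation (path_pmf M \<pi> n s)
     (\<lambda>ss. \<Sum>t<n. reward M (ss ! t, \<pi> (ss ! t)))"

lemma gain_eq_lim: "gain M \<pi> s = lim (\<lambda>n. total_reward \<pi> n s / real n)"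
  unfolding gain_def total_reward_def by (simp add: divide_inverse mult.commute)

context
  fixes \<pi> :: "'s \<Rightarrow> 'a"
  assumes \<pi>: "\<pi> \<in> policies M"
begin

lemma policy_pair: "s \<in> states M \<Longrightarrow> (s, \<pi> s) \<in> sa_pairs M"
  using \<pi> by (auto simp: policies_def)

lemma finite_set_path_pmf: "s \<in> states M \<Longrightarrow> finite (set_pmf (path_pmf M \<pi> n s))"
proof (induction n arbitrary: s)
  case (Suc n)
  have "set_pmf (kernel M (s, \<pi> s)) \<subseteq> states M"
    by (rule set_kernel[OF policy_pair[OF Suc.prems]])
  then show ?case using Suc.IH finite_subset[OF _ finite_states] by auto
qed simp

lemma total_reward_0: "total_reward \<pi> 0 s = 0"
  by (simp add: total_reward_def)

lemma total_reward_Suc: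
  assumes s: "s \<in> states M"
  shows "total_reward \<pi> (Suc n) s
    = reward M (s, \<pi> s) + kernel_mean M (s, \<pi> s) (total_reward \<pi> n)"
proof -
  let ?R = "\<lambda>n ss. \<Sum>t<n. reward M (ss ! t, \<pi> (ss ! t))"
  have step: "measure_pmf.expectation (map_pmf ((#) s) (path_pmf M \<pi> n s')) (?R (Suc n))
      = reward M (s, \<pi> s) + total_reward \<pi> n s'" if "s' \<in> states M" for s'
  proof -
    have "integrable (measure_pmf (path_pmf M \<pi> n s')) (?R n)"
      using finite_set_path_pmf[OF that] by (rule integrable_measure_pmf_finite)
    then show ?thesis
      by (simp add: total_reward_def sum.lessThan_Suc_shift del: sum.lessThan_Suc)
  qed
  have "total_reward \<pi> (Suc n) s
      = (\<Sum>s'\<in>states M. pmf (kernel M (s, \<pi> s)) s' * (reward M (s, \<pi> s) + total_reward \<pi> n s'))"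
    unfolding total_reward_def[of \<pi> "Suc n"] path_pmf.simps
  proof (subst pmf_expectation_bind[OF finite_states])
    show "finite (set_pmf (map_pmf ((#) s) (path_pmf M \<pi> n s')))" if "s' \<in> states M" for s'
      using finite_set_path_pmf[OF that] by simp
    show "set_pmf (kernel M (s, \<pi> s)) \<subseteq> states M"
      by (rule set_kernel[OF policy_pair[OF s]])
  qed (simp add: step del: sum.lessThan_Suc integral_map_pmf)
  also have "\<dots> = reward M (s, \<pi> s) + kernel_mean M (s, \<pi> s) (total_reward \<pi> n)"
    using kernel_mean_const[OF policy_pair[OF s], of "reward M (s, \<pi> s)"]
    unfolding kernel_mean_def by (simp add: algebra_simps sum.distrib)
  finally show ?thesis .
qed

text \<open>The increment is the expected reward of the last step, \<open>P\<^sup>n r\<close>, and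
  averaging never exceeds the largest absolute reward.\<close>

lemma total_reward_increment_bounded:
  obtains R where "\<And>n s. s \<in> states M \<Longrightarrow> \<bar>total_reward \<pi> (Suc n) s - total_reward \<pi> n s\<bar> \<le> R"
    and "\<And>n s. s \<in> states M \<Longrightarrow> \<bar>total_reward \<pi> n s\<bar> \<le> real n * R"
proof -
  define R where "R = Max ((\<lambda>s. \<bar>reward M (s, \<pi> s)\<bar>) ` states M)"
  have incr: "\<bar>total_reward \<pi> (Suc n) s - total_reward \<pi> n s\<bar> \<le> R" if "s \<in> states M" for n s
    using that
  proof (induction n arbitrary: s)
    case 0
    then have "total_reward \<pi> (Suc 0) s - total_reward \<pi> 0 s = reward M (s, \<pi> s)"
      using kernel_mean_const[OF policy_pair[OF 0], of 0]
      by (simp only: total_reward_Suc total_reward_0[abs_def])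
    then show ?case using 0 finite_states by (simp add: R_def)
  next
    case (Suc n)
    have "total_reward \<pi> (Suc (Suc n)) s - total_reward \<pi> (Suc n) s
        = kernel_mean M (s, \<pi> s) (\<lambda>s'. total_reward \<pi> (Suc n) s' - total_reward \<pi> n s')"
      unfolding kernel_mean_diff
      by (subst (1 2) total_reward_Suc[OF Suc.prems]) simp
    then show ?case
      using kernel_mean_abs_le[OF policy_pair[OF Suc.prems]] Suc.IH by simp
  qed
  moreover have "\<bar>total_reward \<pi> n s\<bar> \<le> real n * R" if "s \<in> states M" for n s
  proof (induction n)
    case (Suc n)
    then show ?case using incr[OF that, of n] by (simp add: algebra_simps)
  qed (simp add: total_reward_0)
  ultimately show thesis using that by blast
qed

text \<open>The averages satisfy \<open>P A\<^sub>n - A\<^sub>n = (V\<^sub>n\<^sub>+\<^sub>1 -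
  V\<^sub>n - r) / n\<close>, which tends to 0 by the bounded increments. Every subsequential limit
  is therefore fixed by \<open>P\<close>.\<close>

lemma total_reward_average_subsequence:
  obtains \<phi> f where "strict_mono \<phi>"
    and "\<And>s. s \<in> states M \<Longrightarrow> (\<lambda>n. total_reward \<pi> (\<phi> n) s / real (\<phi> n)) \<longlonglongrightarrow> f s"
    and "\<And>s. s \<in> states M \<Longrightarrow> kernel_mean M (s, \<pi> s) f = f s"
proof -
  let ?A = "\<lambda>n s. total_reward \<pi> n s / real n"
  obtain R where incr: "\<And>n s. s \<in> states M \<Longrightarrow> \<bar>total_reward \<pi> (Suc n) s - total_reward \<pi> n s\<bar> \<le> R"
    and bound: "\<And>n s. s \<in> states M \<Longrightarrow> \<bar>total_reward \<pi> n s\<bar> \<le> real n * R"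
    using total_reward_increment_bounded by blast
  have "\<bar>?A n s\<bar> \<le> \<bar>R\<bar>" if "s \<in> states M" for n s
  proof (cases "n = 0")
    case False
    have "real n * R \<le> real n * \<bar>R\<bar>" by (intro mult_left_mono) auto
    with bound[OF that, of n] have "\<bar>total_reward \<pi> n s\<bar> \<le> real n * \<bar>R\<bar>"
      by (rule order_trans)
    with False show ?thesis by (simp add: divide_le_eq mult.commute)
  qed simp
  then obtain \<phi> f where \<phi>: "strict_mono \<phi>"
    and lim: "\<And>s. s \<in> states M \<Longrightarrow> (\<lambda>n. ?A (\<phi> n) s) \<longlonglongrightarrow> f s"
    using finite_convergent_subsequence[OF finite_states, of ?A "\<bar>R\<bar>"] by blast
  moreover have "kernel_mean M (s, \<pi> s) f = f s" if s: "s \<in> states M" for s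
  proof -
    let ?D = "\<lambda>n. kernel_mean M (s, \<pi> s) (?A n) - ?A n s"
    have D: "?D n = (total_reward \<pi> (Suc n) s - total_reward \<pi> n s - reward M (s, \<pi> s)) / real n" for n
      using kernel_mean_scale[of M "(s, \<pi> s)" "1 / real n" "total_reward \<pi> n"] total_reward_Suc[OF s, of n]
      by (simp add: diff_divide_distrib)
    have "\<bar>?D n\<bar> \<le> (R + \<bar>reward M (s, \<pi> s)\<bar>) / real n" for n
      using incr[OF s, of n] unfolding D by (simp add: divide_right_mono)
    moreover have "(\<lambda>n. (R + \<bar>reward M (s, \<pi> s)\<bar>) / real n) \<longlonglongrightarrow> 0"
      by (rule lim_const_over_n)
    ultimately have "?D \<longlonglongrightarrow> 0"
      by (intro Lim_null_comparison[OF always_eventually, of ?D]) auto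
    then have "(\<lambda>n. ?D (\<phi> n)) \<longlonglongrightarrow> 0"
      using LIMSEQ_subseq_LIMSEQ[OF _ \<phi>] by (simp add: comp_def)
    moreover have "(\<lambda>n. ?D (\<phi> n)) \<longlonglongrightarrow> kernel_mean M (s, \<pi> s) f - f s"
      unfolding kernel_mean_def using lim s by (intro tendsto_intros) auto
    ultimately show ?thesis using LIMSEQ_unique by fastforce
  qed
  ultimately show thesis using that by blast
qed

text \<open>The mean ergodic theorem for the chain of \<open>\<pi>\<close>: with \<open>A\<^sub>m = V\<^sub>m / m\<close> the average of the total
  rewards \<open>V\<^sub>m\<close>, one has \<open>r - A\<^sub>m = u - P u\<close> for \<open>u = (V\<^sub>0 + \<dots> + V\<^sub>m\<^sub>-\<^sub>1) / m\<close>, so that the rewards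
  \<open>r - A\<^sub>m\<close> have bounded partial sums; and \<open>A\<^sub>m\<close> can be taken close to a fixed point of \<open>P\<close>.\<close>

lemma convergent_total_reward_average:
  assumes s: "s \<in> states M"
  shows "convergent (\<lambda>n. total_reward \<pi> n s / real n)"
proof -
  let ?V = "total_reward \<pi>" and ?P = "\<lambda>s. kernel_mean M (s, \<pi> s)"
  obtain \<phi> f where \<phi>: "strict_mono \<phi>"
    and lim: "\<And>s. s \<in> states M \<Longrightarrow> (\<lambda>n. ?V (\<phi> n) s / real (\<phi> n)) \<longlonglongrightarrow> f s"
    and fix_f: "\<And>s. s \<in> states M \<Longrightarrow> ?P s f = f s"
    using total_reward_average_subsequence by blast
  have "(\<lambda>n. ?V n s / real n) \<longlonglongrightarrow> f s"
  proof (rule LIMSEQ_I)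
    fix e :: real assume e: "0 < e"
    have "\<forall>\<^sub>F k in sequentially. \<forall>s\<in>states M. \<bar>?V (\<phi> k) s / real (\<phi> k) - f s\<bar> < e / 2"
    proof (intro eventually_ball_finite[OF finite_states] ballI)
      fix s assume "s \<in> states M"
      from tendstoD[OF lim[OF this], of "e / 2"] e
      show "\<forall>\<^sub>F k in sequentially. \<bar>?V (\<phi> k) s / real (\<phi> k) - f s\<bar> < e / 2"
        by (simp add: dist_real_def)
    qed
    from eventually_conj[OF this eventually_ge_at_top[of 1]]
    obtain k where k: "1 \<le> k" "\<And>s. s \<in> states M \<Longrightarrow> \<bar>?V (\<phi> k) s / real (\<phi> k) - f s\<bar> < e / 2"
      unfolding eventually_sequentially by auto
    define m where "m = \<phi> k"
    have m: "0 < m" using k(1) seq_suble[OF \<phi>, of k] by (simp add: m_def)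
    define u where "u s = 1 / real m * (\<Sum>j<m. ?V j s)" for s
    define U where "U = Max ((\<lambda>s. \<bar>u s\<bar>) ` states M)"
    have U: "\<bar>u s\<bar> \<le> U" if "s \<in> states M" for s
      using that finite_states by (simp add: U_def)
    have cobound: "reward M (s, \<pi> s) = u s - ?P s u + ?V m s / real m" if "s \<in> states M" for s
    proof -
      have "?P s u = 1 / real m * (\<Sum>j<m. ?P s (?V j))"
        unfolding u_def kernel_mean_scale kernel_mean_sum ..
      also have "(\<Sum>j<m. ?P s (?V j)) = (\<Sum>j<m. (?V (Suc j) s - ?V j s) + ?V j s - reward M (s, \<pi> s))"
        by (simp add: total_reward_Suc[OF that])
      also have "\<dots> = ?V m s + (\<Sum>j<m. ?V j s) - real m * reward M (s, \<pi> s)"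
        using sum_lessThan_telescope[of "\<lambda>j. ?V j s" m]
        by (simp add: sum.distrib sum_subtractf total_reward_0)
      finally show ?thesis using m by (simp add: u_def[of s] field_simps)
    qed
    \<comment> \<open>The deviation \<open>X\<^sub>n = V\<^sub>n - n f - u\<close> obeys
      \<open>X\<^sub>n\<^sub>+\<^sub>1 = P X\<^sub>n + (A\<^sub>m - f)\<close>: subtracting
      \<open>u\<close> absorbs the coboundary, and each step costs at most
      \<open>e / 2\<close>.\<close>
    have dev: "\<bar>?V n s - real n * f s - u s\<bar> \<le> U + real n * (e / 2)" if "s \<in> states M" for n s
      using that
    proof (induction n arbitrary: s)
      case 0
      then show ?case using U by (simp add: total_reward_0)
    next
      case (Suc n)
      have "?P s (\<lambda>s'. ?V n s' - real n * f s' - u s') = ?P s (?V n) - real n * f s - ?P s u"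
        using fix_f[OF Suc.prems] by (simp add: kernel_mean_diff kernel_mean_scale)
      then have "?V (Suc n) s - real (Suc n) * f s - u s
          = ?P s (\<lambda>s'. ?V n s' - real n * f s' - u s') + (?V m s / real m - f s)"
        using cobound[OF Suc.prems] total_reward_Suc[OF Suc.prems, of n] by (simp add: algebra_simps)
      moreover have "\<bar>?P s (\<lambda>s'. ?V n s' - real n * f s' - u s')\<bar> \<le> U + real n * (e / 2)"
        by (rule kernel_mean_abs_le[OF policy_pair[OF Suc.prems]]) (rule Suc.IH)
      moreover have "\<bar>?V m s / real m - f s\<bar> < e / 2"
        using k(2)[OF Suc.prems] by (simp add: m_def)
      ultimately have "\<bar>?V (Suc n) s - real (Suc n) * f s - u s\<bar> \<le> U + real n * (e / 2) + e / 2"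
        by linarith
      then show ?case by (simp add: algebra_simps add_divide_distrib)
    qed
    \<comment> \<open>Beyond \<open>n0\<close> the constant \<open>2 * U\<close>, one
      \<open>U\<close> from \<open>dev\<close> and one from \<open>u\<close> itself, is below
      \<open>n * (e / 2)\<close>.\<close>
    obtain n0 :: nat where n0: "4 * U / e < real n0"
      using reals_Archimedean2 by blast
    show "\<exists>no. \<forall>n\<ge>no. norm (?V n s / real n - f s) < e"
    proof (intro exI allI impI)
      fix n assume n: "Suc n0 \<le> n"
      have "4 * U < real n * e"
      proof -
        have "4 * U < real n0 * e" using n0 e by (simp add: field_simps)
        also have "\<dots> \<le> real n * e" using n e by (intro mult_right_mono) auto
        finally show ?thesis .
      qed
      then have "\<bar>?V n s - real n * f s\<bar> < real n * e"
        using dev[OF s, of n] U[OF s] times_divide_eq_right[of "real n" e 2] by linarith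
      moreover have "?V n s / real n - f s = (?V n s - real n * f s) / real n"
        using n by (simp add: field_simps)
      ultimately show "norm (?V n s / real n - f s) < e"
        using n by (simp add: divide_less_eq mult.commute)
    qed
  qed
  then show ?thesis by (rule convergentI)
qed

text \<open>\<open>h\<close> is a potential whose drift inequality telescopes along the chain.
  Subtracting its maximum makes the case \<open>n = 0\<close> true, and averaging preserves the
  bound.\<close>

lemma total_reward_ge:
  assumes "\<And>s. s \<in> states M \<Longrightarrow> c \<le> reward M (s, \<pi> s) + kernel_mean M (s, \<pi> s) h - h s"
    and "s \<in> states M"
  shows "real n * c + h s - Max (h ` states M) \<le> total_reward \<pi> n s"
  using assms(2)
proof (induction n arbitrary: s)
  case 0
  then show ?case using finite_states by (simp add: total_reward_0)
next
  case (Suc n)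
  let ?x = "(s, \<pi> s)"
  have "kernel_mean M ?x (\<lambda>s'. h s' + (real n * c - Max (h ` states M)))
      \<le> kernel_mean M ?x (total_reward \<pi> n)"
    by (intro kernel_mean_mono) (use Suc.IH in \<open>fastforce simp: algebra_simps\<close>)
  then have "kernel_mean M ?x h + (real n * c - Max (h ` states M)) \<le> kernel_mean M ?x (total_reward \<pi> n)"
    by (simp add: kernel_mean_add kernel_mean_const[OF policy_pair[OF Suc.prems]])
  then show ?case
    using assms(1)[OF Suc.prems] total_reward_Suc[OF Suc.prems, of n] by (simp add: algebra_simps)
qed

lemma total_reward_le:
  assumes "\<And>s. s \<in> states M \<Longrightarrow> reward M (s, \<pi> s) + kernel_mean M (s, \<pi> s) h - h s \<le> c"
    and "s \<in> states M"
  shows "total_reward \<pi> n s \<le> real n * c + h s - Min (h ` states M)"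
  using assms(2)
proof (induction n arbitrary: s)
  case 0
  then show ?case using finite_states by (simp add: total_reward_0)
next
  case (Suc n)
  let ?x = "(s, \<pi> s)"
  have "kernel_mean M ?x (total_reward \<pi> n)
      \<le> kernel_mean M ?x (\<lambda>s'. h s' + (real n * c - Min (h ` states M)))"
    by (intro kernel_mean_mono) (use Suc.IH in \<open>fastforce simp: algebra_simps\<close>)
  then have "kernel_mean M ?x (total_reward \<pi> n) \<le> kernel_mean M ?x h + (real n * c - Min (h ` states M))"
    by (simp add: kernel_mean_add kernel_mean_const[OF policy_pair[OF Suc.prems]])
  then show ?case
    using assms(1)[OF Suc.prems] total_reward_Suc[OF Suc.prems, of n] by (simp add: algebra_simps)
qed

text \<open>\<open>gain\<close> is a \<open>lim\<close>, so it inherits bounds only because the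
  averages are known to converge. The potential terms disappear after division by
  \<open>n\<close>.\<close>

lemma gain_ge:
  assumes "\<And>s. s \<in> states M \<Longrightarrow> c \<le> reward M (s, \<pi> s) + kernel_mean M (s, \<pi> s) h - h s"
    and s: "s \<in> states M"
  shows "c \<le> gain M \<pi> s"
proof -
  let ?C = "h s - Max (h ` states M)"
  have "(\<lambda>n. total_reward \<pi> n s / real n) \<longlonglongrightarrow> gain M \<pi> s"
    using convergent_total_reward_average[OF s] by (simp add: gain_eq_lim convergent_LIMSEQ_iff)
  moreover have "(\<lambda>n. c + ?C / real n) \<longlonglongrightarrow> c"
    using tendsto_add[OF tendsto_const lim_const_over_n[of ?C], of c] by simp
  moreover have "c + ?C / real n \<le> total_reward \<pi> n s / real n" if "1 \<le> n" for n
  proof -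
    have "c + ?C / real n = (real n * c + h s - Max (h ` states M)) / real n"
      using that by (simp add: field_simps)
    then show ?thesis using total_reward_ge[OF assms, of n] by (simp add: divide_right_mono)
  qed
  ultimately show ?thesis using LIMSEQ_le by blast
qed

end

section \<open>Greedy policies and the Bellman residual\<close>

lemma greedy_residual:
  assumes "\<pi> \<in> greedy M Q" "s \<in> states M"
  shows "reward M (s, \<pi> s) + kernel_mean M (s, \<pi> s) (max_act M Q) - max_act M Q s
    = bellman M Q (s, \<pi> s) - Q (s, \<pi> s)"
proof -
  have "\<pi> s \<in> actions M" "\<And>a. a \<in> actions M \<Longrightarrow> Q (s, a) \<le> Q (s, \<pi> s)"
    using assms by (auto simp: greedy_def is_arg_max_def not_less)
  then have "max_act M Q s = Q (s, \<pi> s)"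
    using max_act_attained[of Q s] max_act_ge[of "\<pi> s" Q s] by (metis antisym)
  then show ?thesis by (simp add: bellman_eq)
qed

lemma greedy_nonempty: "greedy M Q \<noteq> {}"
proof -
  have "\<exists>a. a \<in> actions M \<and> max_act M Q s = Q (s, a)" for s
    using max_act_attained by metis
  then obtain f where f: "\<And>s. f s \<in> actions M" "\<And>s. max_act M Q s = Q (s, f s)"
    by metis
  have "restrict f (states M) \<in> greedy M Q"
    using f max_act_ge[of _ Q] by (auto simp: greedy_def policies_def is_arg_max_def not_less)
  then show ?thesis by blast
qed

text \<open>A greedy policy for \<open>Qs\<close> earns at least \<open>n * opt_gain M\<close> up to
  a constant, whereas residuals of at most \<open>C\<close> limit every policy to
  \<open>n * C\<close> up to a constant. If \<open>C < opt_gain M\<close>, a large \<open>n\<close>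
  is contradictory.\<close>

lemma opt_gain_le:
  assumes Qs: "bellman_solution M Qs"
    and C: "\<And>x. x \<in> sa_pairs M \<Longrightarrow> bellman M Q x - Q x \<le> C"
  shows "opt_gain M \<le> C"
proof (rule ccontr)
  assume "\<not> opt_gain M \<le> C"
  then have pos: "0 < opt_gain M - C" by simp
  obtain \<pi> where \<pi>: "\<pi> \<in> greedy M Qs" using greedy_nonempty by blast
  then have pol: "\<pi> \<in> policies M" by (simp add: greedy_def)
  obtain s where s: "s \<in> states M" using states_nonempty by blast
  let ?hs = "max_act M Qs" and ?h = "max_act M Q"
  have "opt_gain M \<le> reward M (s, \<pi> s) + kernel_mean M (s, \<pi> s) ?hs - ?hs s" if "s \<in> states M" for s
    using greedy_residual[OF \<pi> that] Qs policy_pair[OF pol that] by (simp add: bellman_solution_def)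
  note lower = total_reward_ge[OF pol this s]
  have "reward M (s, \<pi> s) + kernel_mean M (s, \<pi> s) ?h - ?h s \<le> C" if "s \<in> states M" for s
    using C[OF policy_pair[OF pol that]] max_act_ge[of "\<pi> s" Q s] policy_pair[OF pol that]
    by (simp add: bellman_eq)
  note upper = total_reward_le[OF pol this s]
  let ?B = "?h s - Min (?h ` states M) - ?hs s + Max (?hs ` states M)"
  have "real n * (opt_gain M - C) \<le> ?B" for n
    using lower[of n] upper[of n] by (simp add: algebra_simps)
  moreover obtain n where "?B < real n * (opt_gain M - C)"
    using reals_Archimedean3[OF pos] by blast
  ultimately show False by (meson not_less)
qed

text \<open>The largest residual bounds the optimal gain from above, the smallest bounds the gain of
  the greedy policy from below, and their gap is the span.\<close>

lemma opt_gain_minus_gain_le: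
  assumes Qs: "bellman_solution M Qs" and \<pi>: "\<pi> \<in> greedy M Q" and s: "s \<in> states M"
  shows "opt_gain M - gain M \<pi> s \<le> sp (sa_pairs M) (\<lambda>x. Q x - bellman M Q x)"
proof -
  let ?f = "\<lambda>x. Q x - bellman M Q x"
  have pol: "\<pi> \<in> policies M" using \<pi> by (simp add: greedy_def)
  have f: "?f x \<le> Max (?f ` sa_pairs M)" "Min (?f ` sa_pairs M) \<le> ?f x" if "x \<in> sa_pairs M" for x
    using finite_pairs that by (auto intro: Max_ge Min_le)
  have "opt_gain M \<le> - Min (?f ` sa_pairs M)"
    by (rule opt_gain_le[OF Qs, of Q]) (use f(2) in force)
  moreover have "- Max (?f ` sa_pairs M) \<le> gain M \<pi> s"
  proof (rule gain_ge[OF pol _ s])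
    fix s assume s: "s \<in> states M"
    show "- Max (?f ` sa_pairs M)
        \<le> reward M (s, \<pi> s) + kernel_mean M (s, \<pi> s) (max_act M Q) - max_act M Q s"
      using f(1)[OF policy_pair[OF pol s]] unfolding greedy_residual[OF \<pi> s] by linarith
  qed
  ultimately show ?thesis by (simp add: sp_def)
qed

end


section \<open>Concentration of the sampled tables\<close>

text \<open>Both signs of \<open>l\<close> occur because errors are controlled on both sides; a
  negative \<open>l\<close> becomes positive on replacing \<open>f\<close> by
  \<open>- f\<close>.\<close>

lemma Hoeffdings_lemma_pmf:
  fixes f :: "'b \<Rightarrow> real"
  assumes "\<And>x. x \<in> set_pmf p \<Longrightarrow> f x \<in> {a..b}"
  shows "(\<integral>\<^sup>+x. exp (l * (f x - measure_pmf.expectation p f)) \<partial>measure_pmf p)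
    \<le> ennreal (exp (l\<^sup>2 * (b - a)\<^sup>2 / 8))"
proof -
  have pos: "(\<integral>\<^sup>+x. exp (l * (g x - measure_pmf.expectation p g)) \<partial>measure_pmf p)
      \<le> ennreal (exp (l\<^sup>2 * (d - c)\<^sup>2 / 8))"
    if "0 < l" "\<And>x. x \<in> set_pmf p \<Longrightarrow> g x \<in> {c..d}" for l c d :: real and g :: "'b \<Rightarrow> real"
  proof -
    interpret interval_bounded_random_variable "measure_pmf p" g c d
      by unfold_locales (use that(2) in \<open>auto simp: AE_measure_pmf_iff\<close>)
    show ?thesis by (rule Hoeffdings_lemma_nn_integral[OF that(1)])
  qed
  consider "l = 0" | "0 < l" | "l < 0" by linarith
  then show ?thesis
  proof cases
    case 3
    have "- f x \<in> {- b..- a}" if "x \<in> set_pmf p" for x using assms[OF that] by simp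
    from pos[OF _ this, where l = "- l"] 3 show ?thesis
      by (simp add: algebra_simps power2_commute)
  qed (use pos[OF _ assms] in auto)
qed

lemma nn_integral_exp_replicate_pmf_le:
  fixes f :: "'b \<Rightarrow> real"
  assumes "\<And>x. x \<in> set_pmf p \<Longrightarrow> f x \<in> {a..b}"
  shows "(\<integral>\<^sup>+xs. exp (l * (\<Sum>j<m. f (xs ! j) - measure_pmf.expectation p f)) \<partial>replicate_pmf m p)
    \<le> ennreal (exp (real m * (l\<^sup>2 * (b - a)\<^sup>2 / 8)))"
proof (induction m)
  case (Suc m)
  let ?\<mu> = "measure_pmf.expectation p f"
  let ?g = "\<lambda>x. exp (l * (f x - ?\<mu>))" and ?G = "\<lambda>xs. exp (l * (\<Sum>j<m. f (xs ! j) - ?\<mu>))"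
  have "(\<integral>\<^sup>+xs. exp (l * (\<Sum>j<Suc m. f (xs ! j) - ?\<mu>)) \<partial>replicate_pmf (Suc m) p)
      = (\<integral>\<^sup>+x. \<integral>\<^sup>+xs. ennreal (?g x) * ennreal (?G xs) \<partial>replicate_pmf m p \<partial>p)"
    by (simp add: sum.lessThan_Suc_shift distrib_left exp_add ennreal_mult del: sum.lessThan_Suc)
  also have "\<dots> = (\<integral>\<^sup>+x. ?g x \<partial>p) * (\<integral>\<^sup>+xs. ?G xs \<partial>replicate_pmf m p)"
    by (simp add: nn_integral_cmult nn_integral_multc)
  also have "\<dots> \<le> ennreal (exp (l\<^sup>2 * (b - a)\<^sup>2 / 8)) * ennreal (exp (real m * (l\<^sup>2 * (b - a)\<^sup>2 / 8)))"
    by (intro mult_mono Suc.IH Hoeffdings_lemma_pmf[OF assms]) auto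
  also have "\<dots> = ennreal (exp (real (Suc m) * (l\<^sup>2 * (b - a)\<^sup>2 / 8)))"
    by (simp add: ennreal_mult[symmetric] exp_add[symmetric] algebra_simps)
  finally show ?case .
qed simp

text \<open>A union bound along \<open>bind_pmf\<close>: starts outside \<open>G\<close> are charged
  the full probability 1. It carries the invariant through the iterations and the restarts.\<close>

lemma measure_bind_pmf_le:
  assumes "0 \<le> b" "\<And>x. x \<in> set_pmf p \<Longrightarrow> x \<in> G \<Longrightarrow> measure (measure_pmf (f x)) B \<le> b"
  shows "measure (measure_pmf (bind_pmf p f)) B \<le> measure (measure_pmf p) (- G) + b"
proof -
  have "ennreal (measure (measure_pmf (bind_pmf p f)) B)
      = (\<integral>\<^sup>+x. measure (measure_pmf (f x)) B \<partial>p)"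
    by (simp add: measure_pmf.emeasure_eq_measure[symmetric])
  also have "\<dots> \<le> (\<integral>\<^sup>+x. indicator (- G) x + ennreal b \<partial>p)"
  proof (intro nn_integral_mono_AE, unfold AE_measure_pmf_iff, intro ballI)
    fix x assume "x \<in> set_pmf p"
    then show "ennreal (measure (measure_pmf (f x)) B) \<le> indicator (- G) x + ennreal b"
    proof (cases "x \<in> G")
      case True
      with assms(2)[OF \<open>x \<in> set_pmf p\<close>] show ?thesis by (simp add: ennreal_leI)
    next
      case False
      have "ennreal (measure (measure_pmf (f x)) B) \<le> 1" by simp
      with False show ?thesis by (simp add: add_increasing2)
    qed
  qed
  also have "\<dots> = ennreal (measure (measure_pmf p) (- G) + b)"
    using assms(1) by (simp add: nn_integral_add measure_pmf.emeasure_eq_measure)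
  finally show ?thesis using assms(1) by (simp add: ennreal_plus[symmetric] del: ennreal_plus)
qed

context wf_mdp
begin

text \<open>Only the marginal at \<open>x\<close> enters. Averaging turns \<open>l\<close> into
  \<open>l / m\<close>, and the \<open>m\<close> independent draws add up to
  \<open>m * (l / m)\<^sup>2\<close>.\<close>

lemma nn_integral_exp_SAMPLE_le:
  assumes x: "x \<in> sa_pairs M" and m: "0 < m"
  shows "(\<integral>\<^sup>+D. exp (l * (D x - kernel_mean M x d)) \<partial>SAMPLE M d m)
    \<le> ennreal (exp (l\<^sup>2 * (sp (states M) d)\<^sup>2 / (8 * real m)))"
proof -
  let ?\<mu> = "measure_pmf.expectation (kernel M x) d"
  let ?mean = "\<lambda>ss. 1 / real m * (\<Sum>j<m. d (ss ! j))"
  have \<mu>: "kernel_mean M x d = ?\<mu>" by (rule kernel_mean_eq_expectation[OF x])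
  have mean: "l * (?mean ss - ?\<mu>) = l / real m * (\<Sum>j<m. d (ss ! j) - ?\<mu>)" for ss
    using m by (simp add: sum_subtractf field_simps)
  have bounds: "d s \<in> {Min (d ` states M)..Max (d ` states M)}" if "s \<in> set_pmf (kernel M x)" for s
    using that set_kernel[OF x] finite_states by auto
  have "(\<integral>\<^sup>+D. exp (l * (D x - kernel_mean M x d)) \<partial>SAMPLE M d m)
      = (\<integral>\<^sup>+y. exp (l * (y - ?\<mu>)) \<partial>map_pmf (\<lambda>D. D x) (SAMPLE M d m))"
    by (simp add: \<mu>)
  also have "map_pmf (\<lambda>D. D x) (SAMPLE M d m) = map_pmf ?mean (replicate_pmf m (kernel M x))"
    using x unfolding SAMPLE_def by (subst Pi_pmf_component[OF finite_pairs]) simp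
  also have "(\<integral>\<^sup>+y. exp (l * (y - ?\<mu>)) \<partial>map_pmf ?mean (replicate_pmf m (kernel M x)))
      = (\<integral>\<^sup>+ss. exp (l / real m * (\<Sum>j<m. d (ss ! j) - ?\<mu>)) \<partial>replicate_pmf m (kernel M x))"
    by (simp only: nn_integral_map_pmf mean)
  also have "\<dots> \<le> ennreal (exp (real m * ((l / real m)\<^sup>2 * (sp (states M) d)\<^sup>2 / 8)))"
    unfolding sp_def by (rule nn_integral_exp_replicate_pmf_le[OF bounds])
  also have "real m * ((l / real m)\<^sup>2 * (sp (states M) d)\<^sup>2 / 8)
      = l\<^sup>2 * (sp (states M) d)\<^sup>2 / (8 * real m)"
    using m by (simp add: power2_eq_square)
  finally show ?thesis .
qed

lemma SAMPLE_bounds: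
  assumes "D \<in> set_pmf (SAMPLE M d m)" "x \<in> sa_pairs M" "0 < m"
  shows "Min (d ` states M) \<le> D x" "D x \<le> Max (d ` states M)"
proof -
  have "D x \<in> set_pmf (map_pmf (\<lambda>D. D x) (SAMPLE M d m))" using assms(1) by simp
  also have "map_pmf (\<lambda>D. D x) (SAMPLE M d m)
      = map_pmf (\<lambda>ss. 1 / real m * (\<Sum>j<m. d (ss ! j))) (replicate_pmf m (kernel M x))"
    using assms(2) unfolding SAMPLE_def by (subst Pi_pmf_component[OF finite_pairs]) simp
  finally obtain ss where ss: "length ss = m" "set ss \<subseteq> set_pmf (kernel M x)"
    and D: "D x = 1 / real m * (\<Sum>j<m. d (ss ! j))"
    by (auto simp: set_replicate_pmf lists_eq_set)
  have "ss ! j \<in> states M" if "j < m" for j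
    using ss that set_kernel[OF assms(2)] nth_mem by blast
  then have "Min (d ` states M) \<le> d (ss ! j)" "d (ss ! j) \<le> Max (d ` states M)" if "j < m" for j
    using that finite_states by auto
  then have "(\<Sum>j<m. Min (d ` states M)) \<le> (\<Sum>j<m. d (ss ! j))"
    "(\<Sum>j<m. d (ss ! j)) \<le> (\<Sum>j<m. Max (d ` states M))"
    by (intro sum_mono; simp)+
  then show "Min (d ` states M) \<le> D x" "D x \<le> Max (d ` states M)"
    using assms(3) by (simp_all add: D field_simps)
qed

lemma sp_SAMPLE_le:
  assumes "D \<in> set_pmf (SAMPLE M d m)" "0 < m"
  shows "sp (sa_pairs M) D \<le> sp (states M) d"
  unfolding sp_le_iff[OF finite_pairs pairs_nonempty]
proof (intro ballI)
  fix x y assume "x \<in> sa_pairs M" "y \<in> sa_pairs M"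
  then show "D x - D y \<le> sp (states M) d"
    using SAMPLE_bounds(2)[OF assms(1) _ assms(2), of x] SAMPLE_bounds(1)[OF assms(1) _ assms(2), of y]
    by (simp add: sp_def)
qed

text \<open>As \<open>h\<close> starts at 0, this telescopes to the sum of all
  \<open>D\<^sup>i - P d\<^sup>i\<close>, the accumulated sampling noise. Once \<open>h\<close> is
  \<open>max_act M Q\<close> it equals \<open>T - bellman M Q\<close>.\<close>

definition table_error :: "('s, 'a) config \<Rightarrow> 's \<times> 'a \<Rightarrow> real" where
  "table_error = (\<lambda>(Q, T, h, N, W) x. T x - reward M x - kernel_mean M x h)"

end

section \<open>Chernoff bounds for the accumulated sampling error\<close>

locale savia = wf_mdp M for M :: "('s, 'a) mdp" +
  fixes c \<beta> :: "nat \<Rightarrow> real" and Q0 :: "'s \<times> 'a \<Rightarrow> real" and \<epsilon> \<alpha> :: real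
  assumes \<epsilon>_pos: "0 < \<epsilon>" and \<alpha>_pos: "0 < \<alpha>" and c_pos: "0 < c k"
    and sum_inverse_c: "(\<Sum>i<k. 1 / c i) \<le> 2"
begin

abbreviation "iter \<equiv> savia_iter M c \<beta> Q0 \<epsilon> \<alpha>"
abbreviation "step \<equiv> savia_step M c \<beta> Q0 \<epsilon> \<alpha>"

definition sample_size :: "nat \<Rightarrow> ('s \<Rightarrow> real) \<Rightarrow> nat" where
  "sample_size k d = max (nat \<lceil>\<alpha> * c k * (sp (states M) d)\<^sup>2 / \<epsilon>\<^sup>2\<rceil>) 1"

lemma sample_size_pos: "0 < sample_size k d"
  by (simp add: sample_size_def)

lemma sample_size_ge: "\<alpha> * c k * (sp (states M) d)\<^sup>2 / \<epsilon>\<^sup>2 \<le> real (sample_size k d)"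
  unfolding sample_size_def by linarith

lemma sample_size_le: "real (sample_size k d) \<le> \<alpha> * c k * (sp (states M) d)\<^sup>2 / \<epsilon>\<^sup>2 + 1"
proof -
  have "0 \<le> \<alpha> * c k * (sp (states M) d)\<^sup>2 / \<epsilon>\<^sup>2"
    using \<alpha>_pos c_pos[of k] by simp
  then show ?thesis unfolding sample_size_def by linarith
qed

text \<open>Given \<open>y\<close> the sample size is a constant, and its lower bound cancels the
  span of \<open>d\<close>. The second factor is thus free of \<open>y\<close> and can be pulled out
  when the steps are iterated.\<close>

lemma nn_integral_exp_step_le:
  assumes x: "x \<in> sa_pairs M"
  shows "(\<integral>\<^sup>+z. exp (l * table_error z x) \<partial>step k y)
    \<le> ennreal (exp (l * table_error y x)) * ennreal (exp (l\<^sup>2 * \<epsilon>\<^sup>2 / (8 * \<alpha>) * (1 / c k)))"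
proof -
  obtain Q T h N W where y: "y = (Q, T, h, N, W)" by (cases y)
  define h' where "h' = max_act M (\<lambda>x. (1 - \<beta> k) * Q0 x + \<beta> k * T x)"
  define d where "d s = h' s - h s" for s
  let ?m = "sample_size k d"
  have "(\<integral>\<^sup>+z. exp (l * table_error z x) \<partial>step k y)
      = (\<integral>\<^sup>+D. exp (l * (T x + D x - reward M x - kernel_mean M x h')) \<partial>SAMPLE M d ?m)"
    unfolding y savia_step_def Let_def prod.case h'_def d_def sample_size_def
    by (simp add: table_error_def)
  also have "\<dots> = (\<integral>\<^sup>+D. ennreal (exp (l * table_error y x))
      * ennreal (exp (l * (D x - kernel_mean M x d))) \<partial>SAMPLE M d ?m)"
  proof -
    have "kernel_mean M x h' = kernel_mean M x d + kernel_mean M x h"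
      using kernel_mean_diff[of M x h' h] by (simp add: d_def[abs_def])
    then show ?thesis
      by (simp add: y table_error_def ennreal_mult[symmetric] exp_add[symmetric] algebra_simps)
  qed
  also have "\<dots> = ennreal (exp (l * table_error y x))
      * (\<integral>\<^sup>+D. exp (l * (D x - kernel_mean M x d)) \<partial>SAMPLE M d ?m)"
    by (simp add: nn_integral_cmult)
  also have "\<dots> \<le> ennreal (exp (l * table_error y x))
      * ennreal (exp (l\<^sup>2 * \<epsilon>\<^sup>2 / (8 * \<alpha>) * (1 / c k)))"
  proof (intro mult_left_mono order_trans[OF nn_integral_exp_SAMPLE_le[OF x sample_size_pos]])
    have "(sp (states M) d)\<^sup>2 / real ?m \<le> \<epsilon>\<^sup>2 / (\<alpha> * c k)"
      using sample_size_ge[of k d] \<epsilon>_pos \<alpha>_pos c_pos[of k] sample_size_pos[of k d]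
      by (simp add: field_simps)
    then have "l\<^sup>2 / 8 * ((sp (states M) d)\<^sup>2 / real ?m) \<le> l\<^sup>2 / 8 * (\<epsilon>\<^sup>2 / (\<alpha> * c k))"
      by (intro mult_left_mono) auto
    then show "ennreal (exp (l\<^sup>2 * (sp (states M) d)\<^sup>2 / (8 * real ?m)))
        \<le> ennreal (exp (l\<^sup>2 * \<epsilon>\<^sup>2 / (8 * \<alpha>) * (1 / c k)))"
      by (intro ennreal_leI) (simp add: mult.assoc)
  qed auto
  finally show ?thesis .
qed

lemma nn_integral_exp_iter_le:
  assumes x: "x \<in> sa_pairs M"
  shows "(\<integral>\<^sup>+z. exp (l * table_error z x) \<partial>iter k)
    \<le> ennreal (exp (l\<^sup>2 * \<epsilon>\<^sup>2 / (8 * \<alpha>) * (\<Sum>i<k. 1 / c i)))"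
proof (induction k)
  case 0
  then show ?case by (simp add: table_error_def kernel_mean_def)
next
  case (Suc k)
  let ?C = "\<lambda>s. ennreal (exp (l\<^sup>2 * \<epsilon>\<^sup>2 / (8 * \<alpha>) * s))"
  have "(\<integral>\<^sup>+z. exp (l * table_error z x) \<partial>iter (Suc k))
      = (\<integral>\<^sup>+y. \<integral>\<^sup>+z. exp (l * table_error z x) \<partial>step k y \<partial>iter k)"
    by simp
  also have "\<dots> \<le> (\<integral>\<^sup>+y. ennreal (exp (l * table_error y x)) * ?C (1 / c k) \<partial>iter k)"
    by (intro nn_integral_mono nn_integral_exp_step_le x)
  also have "\<dots> = (\<integral>\<^sup>+y. exp (l * table_error y x) \<partial>iter k) * ?C (1 / c k)"
    by (simp add: nn_integral_multc)
  also have "\<dots> \<le> ?C (\<Sum>i<k. 1 / c i) * ?C (1 / c k)"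
    by (intro mult_right_mono Suc.IH) auto
  also have "\<dots> = ?C (\<Sum>i<Suc k. 1 / c i)"
    by (simp add: ennreal_mult[symmetric] exp_add[symmetric] distrib_left)
  finally show ?case .
qed

lemma table_error_tail:
  assumes x: "x \<in> sa_pairs M" and \<sigma>: "\<bar>\<sigma>\<bar> = 1"
  shows "measure (iter k) {z. \<epsilon> \<le> \<sigma> * table_error z x} \<le> exp (- \<alpha>)"
proof -
  \<comment> \<open>the minimiser of the Chernoff exponent \<open>- l \<epsilon> + l\<^sup>2 \<epsilon>\<^sup>2 / (4 \<alpha>)\<close>\<close>
  define l where "l = 2 * \<alpha> / \<epsilon>"
  have l: "0 < l" "l * \<epsilon> = 2 * \<alpha>" using \<alpha>_pos \<epsilon>_pos by (simp_all add: l_def)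
  have \<sigma>2: "\<sigma>\<^sup>2 = 1" using \<sigma> by (metis one_power2 power2_abs)
  have "ennreal (measure (iter k) {z. \<epsilon> \<le> \<sigma> * table_error z x})
      = emeasure (iter k) {z\<in>UNIV. 1 \<le> ennreal (exp (- 2 * \<alpha>)) * ennreal (exp (l * \<sigma> * table_error z x))}"
  proof -
    have "1 \<le> ennreal (exp (- 2 * \<alpha>)) * ennreal (exp (l * \<sigma> * table_error z x))
        \<longleftrightarrow> \<epsilon> \<le> \<sigma> * table_error z x" for z
    proof -
      have "1 \<le> ennreal (exp (- 2 * \<alpha>)) * ennreal (exp (l * \<sigma> * table_error z x))
          \<longleftrightarrow> l * \<epsilon> \<le> l * (\<sigma> * table_error z x)"
        by (simp add: ennreal_mult[symmetric] exp_add[symmetric] l(2) mult.assoc)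
      also have "\<dots> \<longleftrightarrow> \<epsilon> \<le> \<sigma> * table_error z x" using l(1) by simp
      finally show ?thesis .
    qed
    then show ?thesis by (simp add: measure_pmf.emeasure_eq_measure)
  qed
  also have "\<dots> \<le> ennreal (exp (- 2 * \<alpha>)) * (\<integral>\<^sup>+z. ennreal (exp (l * \<sigma> * table_error z x)) * indicator UNIV z \<partial>iter k)"
    by (rule nn_integral_Markov_inequality) auto
  also have "\<dots> \<le> ennreal (exp (- 2 * \<alpha>)) * ennreal (exp ((l * \<sigma>)\<^sup>2 * \<epsilon>\<^sup>2 / (8 * \<alpha>) * (\<Sum>i<k. 1 / c i)))"
    using nn_integral_exp_iter_le[OF x, where l = "l * \<sigma>" and k = k] by (simp add: mult_left_mono)
  also have "(l * \<sigma>)\<^sup>2 * \<epsilon>\<^sup>2 / (8 * \<alpha>) = \<alpha> / 2"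
  proof -
    have "(l * \<sigma>)\<^sup>2 = l\<^sup>2" by (simp add: power_mult_distrib \<sigma>2)
    then show ?thesis using \<alpha>_pos \<epsilon>_pos by (simp add: l_def power2_eq_square)
  qed
  also have "ennreal (exp (- 2 * \<alpha>)) * ennreal (exp (\<alpha> / 2 * (\<Sum>i<k. 1 / c i)))
      = ennreal (exp (- 2 * \<alpha> + \<alpha> / 2 * (\<Sum>i<k. 1 / c i)))"
    by (simp add: ennreal_mult[symmetric] exp_add[symmetric])
  \<comment> \<open>The bound 2 on the sum of \<open>1 / c i\<close> is exactly what leaves
    \<open>- \<alpha>\<close> in the exponent.\<close>
  also have "\<dots> \<le> ennreal (exp (- \<alpha>))"
  proof -
    have "\<alpha> / 2 * (\<Sum>i<k. 1 / c i) \<le> \<alpha> / 2 * 2"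
      using \<alpha>_pos by (intro mult_left_mono sum_inverse_c) auto
    then show ?thesis by (intro ennreal_leI) simp
  qed
  finally show ?thesis by simp
qed

lemma prob_table_error_gt:
  "measure (iter k) {z. \<exists>x\<in>sa_pairs M. \<epsilon> < \<bar>table_error z x\<bar>}
    \<le> 2 * real (card (states M) * card (actions M)) * exp (- \<alpha>)"
proof -
  let ?B = "\<lambda>x. {z. \<epsilon> \<le> 1 * table_error z x} \<union> {z. \<epsilon> \<le> (- 1) * table_error z x}"
  have B: "measure (iter k) (?B x) \<le> 2 * exp (- \<alpha>)" if "x \<in> sa_pairs M" for x
  proof -
    have "measure (iter k) (?B x) \<le> measure (iter k) {z. \<epsilon> \<le> 1 * table_error z x}
        + measure (iter k) {z. \<epsilon> \<le> (- 1) * table_error z x}"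
      by (rule measure_Un_le) auto
    also have "\<dots> \<le> exp (- \<alpha>) + exp (- \<alpha>)"
      by (intro add_mono table_error_tail that) auto
    finally show ?thesis by simp
  qed
  have "measure (iter k) {z. \<exists>x\<in>sa_pairs M. \<epsilon> < \<bar>table_error z x\<bar>} \<le> measure (iter k) (\<Union>x\<in>sa_pairs M. ?B x)"
    by (intro measure_pmf.finite_measure_mono) (auto simp: abs_if split: if_splits)
  also have "\<dots> \<le> (\<Sum>x\<in>sa_pairs M. measure (iter k) (?B x))"
    by (rule measure_UNION_le[OF finite_pairs]) auto
  also have "\<dots> \<le> (\<Sum>x\<in>sa_pairs M. 2 * exp (- \<alpha>))"
    by (intro sum_mono B)
  also have "\<dots> = 2 * real (card (states M) * card (actions M)) * exp (- \<alpha>)"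
    by (simp add: card_cartesian_product)
  finally show ?thesis .
qed

end


section \<open>Anchored value iteration\<close>

locale anchored_savia = savia M c \<beta> Q0 \<epsilon> \<alpha>
  for M :: "('s, 'a) mdp" and c \<beta> Q0 \<epsilon> \<alpha> +
  fixes Qs :: "'s \<times> 'a \<Rightarrow> real"
  assumes \<beta>_eq: "\<beta> k = real k / (real k + 2)"
    and bellman_solution: "bellman_solution M Qs"
begin

definition \<mu> :: real where
  "\<mu> = sp (sa_pairs M) (\<lambda>x. Q0 x - Qs x)"

definition table_size :: nat where
  "table_size = card (states M) * card (actions M)"

text \<open>A supersolution of the recursion for the span of
  \<open>Q\<^sup>k - Q\<^sup>k\<^sup>-\<^sup>1\<close>: the term \<open>2 * \<epsilon> / 3\<close>
  reproduces itself exactly, the term with \<open>\<mu>\<close> with some slack.\<close>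

definition increment_bound :: "nat \<Rightarrow> real" where
  "increment_bound k = 4 * \<mu> / (real k + 1) + 2 * \<epsilon> / 3"

text \<open>Iteration 0 differs because \<open>h\<close> starts at 0, so \<open>d\<^sup>0\<close> is
  \<open>max_act M Q0\<close> and not a difference of iterates; this is how the span of
  \<open>Q0\<close> enters \<open>\<nu>\<close>. The \<open>+ 1\<close> pays for rounding up and for
  the minimum of one sample.\<close>

definition sample_bound :: "nat \<Rightarrow> real" where
  "sample_bound n = (\<Sum>k\<le>n. \<alpha> * c k
     * (if k = 0 then sp (sa_pairs M) Q0 else increment_bound k)\<^sup>2 / \<epsilon>\<^sup>2 + 1)"

text \<open>The state after iteration \<open>k\<close>. The previous table \<open>T\<^sup>k\<^sup>-\<^sup>1\<close> is not part of a configuration, but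
  \<open>\<beta>\<^sub>k T\<^sup>k\<^sup>-\<^sup>1 = Q\<^sup>k - (1 - \<beta>\<^sub>k) Q\<^sup>0\<close>, so the fourth condition says \<open>\<beta>\<^sub>k (T\<^sup>k - T\<^sup>k\<^sup>-\<^sup>1)\<close> has small span.\<close>

definition iterate_ok :: "nat \<Rightarrow> ('s, 'a) config \<Rightarrow> bool" where
  "iterate_ok k = (\<lambda>(Q, T, h, N, W).
     (\<forall>x\<in>sa_pairs M. \<bar>table_error (Q, T, h, N, W) x\<bar> \<le> \<epsilon>) \<and>
     h = max_act M Q \<and>
     sp (sa_pairs M) (\<lambda>x. Q x - Qs x) \<le> \<mu> + 2 * \<epsilon> * real k / 3 \<and>
     sp (sa_pairs M) (\<lambda>x. \<beta> k * T x + (1 - \<beta> k) * Q0 x - Q x) \<le> \<beta> k * increment_bound k \<and>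
     real N \<le> real table_size * sample_bound k \<and>
     W = N + table_size * Suc k \<and> table_size * Suc k \<le> N)"

lemma \<mu>_nonneg: "0 \<le> \<mu>"
  unfolding \<mu>_def by (rule sp_nonneg[OF finite_pairs pairs_nonempty])

lemma \<beta>_nonneg: "0 \<le> \<beta> k" and \<beta>_le_1: "\<beta> k \<le> 1"
  by (simp_all add: \<beta>_eq)

lemma sp_table_minus_bellman_le:
  assumes "iterate_ok k (Q, T, h, N, W)"
  shows "sp (sa_pairs M) (\<lambda>x. T x - bellman M Q x) \<le> 2 * \<epsilon>"
proof (rule sp_le_abs_bound[OF finite_pairs pairs_nonempty])
  fix x assume "x \<in> sa_pairs M"
  with assms show "\<bar>T x - bellman M Q x\<bar> \<le> \<epsilon>"
    by (auto simp: iterate_ok_def table_error_def bellman_eq algebra_simps)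
qed

text \<open>\<open>Qs\<close> is fixed by the Bellman operator up to the constant
  \<open>opt_gain M\<close>, which the span ignores; the sampling error adds
  \<open>2 * \<epsilon>\<close>.\<close>

lemma sp_table_minus_solution_le:
  assumes ok: "iterate_ok k (Q, T, h, N, W)"
  shows "sp (sa_pairs M) (\<lambda>x. T x - Qs x) \<le> \<mu> + 2 * \<epsilon> * (real k + 3) / 3"
proof -
  let ?sp = "sp (sa_pairs M)"
  have "?sp (\<lambda>x. T x - Qs x) = ?sp (\<lambda>x. (T x - bellman M Q x) + (bellman M Q x - bellman M Qs x) + opt_gain M)"
  proof (rule sp_cong)
    fix x assume "x \<in> sa_pairs M"
    then have "Qs x = bellman M Qs x - opt_gain M"
      using bellman_solution unfolding bellman_solution_def by blast
    then show "T x - Qs x = (T x - bellman M Q x) + (bellman M Q x - bellman M Qs x) + opt_gain M"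
      by simp
  qed
  also have "\<dots> \<le> ?sp (\<lambda>x. (T x - bellman M Q x) + (bellman M Q x - bellman M Qs x))"
    by (rule sp_add_const_le[OF finite_pairs pairs_nonempty])
  also have "\<dots> \<le> ?sp (\<lambda>x. T x - bellman M Q x) + ?sp (\<lambda>x. bellman M Q x - bellman M Qs x)"
    by (rule sp_add_le[OF finite_pairs pairs_nonempty])
  also have "\<dots> \<le> 2 * \<epsilon> + (\<mu> + 2 * \<epsilon> * real k / 3)"
    using sp_table_minus_bellman_le[OF ok] sp_bellman_diff_le[of Q Qs] ok
    by (auto simp: iterate_ok_def)
  also have "\<dots> = \<mu> + 2 * \<epsilon> * (real k + 3) / 3" by (simp add: field_simps)
  finally show ?thesis .
qed

lemma sp_table_minus_anchor_le:
  assumes ok: "iterate_ok k (Q, T, h, N, W)"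
  shows "sp (sa_pairs M) (\<lambda>x. T x - Q0 x) \<le> 2 * \<mu> + 2 * \<epsilon> * (real k + 3) / 3"
proof -
  have "sp (sa_pairs M) (\<lambda>x. T x - Q0 x) = sp (sa_pairs M) (\<lambda>x. (T x - Qs x) - (Q0 x - Qs x))"
    by simp
  also have "\<dots> \<le> sp (sa_pairs M) (\<lambda>x. T x - Qs x) + \<mu>"
    unfolding \<mu>_def by (rule sp_diff_le[OF finite_pairs pairs_nonempty])
  finally show ?thesis using sp_table_minus_solution_le[OF ok] by simp
qed

text \<open>Since \<open>\<beta>\<^sub>k\<^sub>+\<^sub>1 (k + 3) = k + 1\<close>, anchoring damps
  \<open>k + 3\<close> units of \<open>2 * \<epsilon> / 3\<close> to \<open>k + 1\<close>. The fresh
  error \<open>2 * \<epsilon>\<close>, three units, costs only one.\<close>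

lemma sp_next_iterate_minus_solution_le:
  assumes ok: "iterate_ok k (Q, T, h, N, W)"
  shows "sp (sa_pairs M) (\<lambda>x. (1 - \<beta> (Suc k)) * Q0 x + \<beta> (Suc k) * T x - Qs x)
    \<le> \<mu> + 2 * \<epsilon> * real (Suc k) / 3"
proof -
  let ?b = "\<beta> (Suc k)" and ?sp = "sp (sa_pairs M)"
  have "?sp (\<lambda>x. (1 - ?b) * Q0 x + ?b * T x - Qs x)
      = ?sp (\<lambda>x. (1 - ?b) * (Q0 x - Qs x) + ?b * (T x - Qs x))"
    by (simp add: algebra_simps)
  also have "\<dots> \<le> ?sp (\<lambda>x. (1 - ?b) * (Q0 x - Qs x)) + ?sp (\<lambda>x. ?b * (T x - Qs x))"
    by (rule sp_add_le[OF finite_pairs pairs_nonempty])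
  also have "\<dots> \<le> (1 - ?b) * \<mu> + ?b * ?sp (\<lambda>x. T x - Qs x)"
    unfolding \<mu>_def
    by (intro add_mono sp_scale_le finite_pairs pairs_nonempty) (simp_all add: \<beta>_nonneg \<beta>_le_1)
  also have "\<dots> \<le> (1 - ?b) * \<mu> + ?b * (\<mu> + 2 * \<epsilon> * (real k + 3) / 3)"
    by (intro add_left_mono mult_left_mono sp_table_minus_solution_le[OF ok] \<beta>_nonneg)
  also have "\<dots> = \<mu> + 2 * \<epsilon> * real (Suc k) / 3"
    by (simp add: \<beta>_eq divide_simps) (simp add: algebra_simps)
  finally show ?thesis .
qed

text \<open>The difference is \<open>(\<beta>\<^sub>k\<^sub>+\<^sub>1 - \<beta>\<^sub>k) (T\<^sup>k
  - Q\<^sup>0) + \<beta>\<^sub>k (T\<^sup>k - T\<^sup>k\<^sup>-\<^sup>1)\<close>; the invariant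
  supplies the second summand without mentioning \<open>T\<^sup>k\<^sup>-\<^sup>1\<close>.\<close>

lemma sp_next_iterate_minus_iterate_le:
  assumes ok: "iterate_ok k (Q, T, h, N, W)"
  shows "sp (sa_pairs M) (\<lambda>x. (1 - \<beta> (Suc k)) * Q0 x + \<beta> (Suc k) * T x - Q x)
    \<le> increment_bound (Suc k)"
proof -
  let ?b = "\<beta> (Suc k)" and ?a = "\<beta> k" and ?sp = "sp (sa_pairs M)"
  have ba: "?b - ?a = 2 / ((real k + 2) * (real k + 3))"
    by (simp add: \<beta>_eq divide_simps) (simp add: algebra_simps)
  have "?sp (\<lambda>x. (1 - ?b) * Q0 x + ?b * T x - Q x)
      = ?sp (\<lambda>x. (?b - ?a) * (T x - Q0 x) + (?a * T x + (1 - ?a) * Q0 x - Q x))"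
    by (simp add: algebra_simps)
  also have "\<dots> \<le> ?sp (\<lambda>x. (?b - ?a) * (T x - Q0 x)) + ?sp (\<lambda>x. ?a * T x + (1 - ?a) * Q0 x - Q x)"
    by (rule sp_add_le[OF finite_pairs pairs_nonempty])
  also have "\<dots> \<le> (?b - ?a) * (2 * \<mu> + 2 * \<epsilon> * (real k + 3) / 3) + ?a * increment_bound k"
  proof (intro add_mono)
    have "?sp (\<lambda>x. (?b - ?a) * (T x - Q0 x)) \<le> (?b - ?a) * ?sp (\<lambda>x. T x - Q0 x)"
      by (intro sp_scale_le finite_pairs pairs_nonempty) (simp add: ba)
    also have "\<dots> \<le> (?b - ?a) * (2 * \<mu> + 2 * \<epsilon> * (real k + 3) / 3)"
      by (intro mult_left_mono sp_table_minus_anchor_le[OF ok]) (simp add: ba)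
    finally show "?sp (\<lambda>x. (?b - ?a) * (T x - Q0 x)) \<le> \<dots>" .
  qed (use ok in \<open>simp add: iterate_ok_def\<close>)
  also have "\<dots> = \<mu> * (4 / ((real k + 2) * (real k + 3)) + 4 * real k / ((real k + 1) * (real k + 2)))
      + 2 * \<epsilon> / 3"
    unfolding ba by (simp add: \<beta>_eq increment_bound_def divide_simps) (simp add: algebra_simps)
  also have "\<dots> \<le> \<mu> * (4 / (real k + 2)) + 2 * \<epsilon> / 3"
  proof (intro add_right_mono mult_left_mono \<mu>_nonneg)
    \<comment> \<open>After division by \<open>4 / (k + 2)\<close> this is
      \<open>1 / (k + 3) \<le> 1 / (k + 1)\<close>.\<close>
    show "4 / ((real k + 2) * (real k + 3)) + 4 * real k / ((real k + 1) * (real k + 2)) \<le> 4 / (real k + 2)"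
      by (simp add: divide_simps) (simp add: algebra_simps)
  qed
  also have "\<dots> = increment_bound (Suc k)"
    by (simp add: increment_bound_def add.commute)
  finally show ?thesis .
qed

text \<open>The same splitting with weight \<open>1 - \<beta>\<^sub>k = 2 / (k + 2)\<close> on
  \<open>T - Q0\<close>, which turns the linear drift into a bounded error. The two terms with
  \<open>\<mu>\<close> contribute at most \<open>4 * \<mu> / (k + 2)\<close> each.\<close>

lemma sp_iterate_minus_table_le:
  assumes ok: "iterate_ok k (Q, T, h, N, W)"
  shows "sp (sa_pairs M) (\<lambda>x. Q x - T x) \<le> 8 * \<mu> / (real k + 2) + 3 * \<epsilon>"
proof -
  let ?a = "\<beta> k" and ?sp = "sp (sa_pairs M)"
  have "?sp (\<lambda>x. Q x - T x) = ?sp (\<lambda>x. - ((1 - ?a) * (T x - Q0 x) + (?a * T x + (1 - ?a) * Q0 x - Q x)))"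
    by (simp add: algebra_simps)
  also have "\<dots> = ?sp (\<lambda>x. (1 - ?a) * (T x - Q0 x) + (?a * T x + (1 - ?a) * Q0 x - Q x))"
    by (rule sp_minus[OF finite_pairs pairs_nonempty])
  also have "\<dots> \<le> ?sp (\<lambda>x. (1 - ?a) * (T x - Q0 x)) + ?sp (\<lambda>x. ?a * T x + (1 - ?a) * Q0 x - Q x)"
    by (rule sp_add_le[OF finite_pairs pairs_nonempty])
  also have "\<dots> \<le> (1 - ?a) * (2 * \<mu> + 2 * \<epsilon> * (real k + 3) / 3) + ?a * increment_bound k"
  proof (intro add_mono)
    have "?sp (\<lambda>x. (1 - ?a) * (T x - Q0 x)) \<le> (1 - ?a) * ?sp (\<lambda>x. T x - Q0 x)"
      by (intro sp_scale_le finite_pairs pairs_nonempty) (simp add: \<beta>_le_1)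
    also have "\<dots> \<le> (1 - ?a) * (2 * \<mu> + 2 * \<epsilon> * (real k + 3) / 3)"
      by (intro mult_left_mono sp_table_minus_anchor_le[OF ok]) (simp add: \<beta>_le_1)
    finally show "?sp (\<lambda>x. (1 - ?a) * (T x - Q0 x)) \<le> \<dots>" .
  qed (use ok in \<open>simp add: iterate_ok_def\<close>)
  also have "\<dots> = \<mu> * (4 / (real k + 2) + 4 * real k / ((real k + 1) * (real k + 2)))
      + \<epsilon> * (4 * (real k + 3) / (3 * (real k + 2)) + 2 * real k / (3 * (real k + 2)))"
    by (simp add: \<beta>_eq increment_bound_def divide_simps) (simp add: algebra_simps)
  also have "\<dots> \<le> \<mu> * (8 / (real k + 2)) + \<epsilon> * 3"
  proof (intro add_mono mult_left_mono \<mu>_nonneg less_imp_le[OF \<epsilon>_pos])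
    show "4 / (real k + 2) + 4 * real k / ((real k + 1) * (real k + 2)) \<le> 8 / (real k + 2)"
      by (simp add: divide_simps)
    show "4 * (real k + 3) / (3 * (real k + 2)) + 2 * real k / (3 * (real k + 2)) \<le> 3"
      by (simp add: divide_simps)
  qed
  finally show ?thesis by (simp add: mult.commute)
qed

lemma iterate_ok_0:
  assumes z: "z \<in> set_pmf (step 0 (Q0, reward M, \<lambda>_. 0, 0, 0))"
    and err: "\<forall>x\<in>sa_pairs M. \<bar>table_error z x\<bar> \<le> \<epsilon>"
  shows "iterate_ok 0 z"
proof -
  define m where "m = sample_size 0 (max_act M Q0)"
  have \<beta>0: "\<beta> 0 = 0" by (simp add: \<beta>_eq)
  from z obtain D where D: "z = (Q0, \<lambda>x. reward M x + D x, max_act M Q0, table_size * m,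
      table_size * m + table_size)"
    unfolding savia_step_def Let_def prod.case m_def sample_size_def table_size_def
    by (auto simp: \<beta>0 algebra_simps)
  have "real m \<le> \<alpha> * c 0 * (sp (states M) (max_act M Q0))\<^sup>2 / \<epsilon>\<^sup>2 + 1"
    unfolding m_def by (rule sample_size_le)
  also have "\<dots> \<le> sample_bound 0"
    unfolding sample_bound_def using \<alpha>_pos c_pos[of 0]
    by (simp add: sp_max_act_le sp_nonneg finite_states states_nonempty divide_right_mono mult_left_mono power_mono)
  finally have "real table_size * real m \<le> real table_size * sample_bound 0"
    by (intro mult_left_mono) auto
  moreover have "0 < m" unfolding m_def by (rule sample_size_pos)
  moreover have "sp (sa_pairs M) (\<lambda>x. 0) \<le> 0"
    by (simp add: sp_le_iff[OF finite_pairs pairs_nonempty])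
  ultimately show ?thesis
    using err unfolding D iterate_ok_def by (simp add: \<beta>0 \<mu>_def)
qed

text \<open>Apart from \<open>err\<close> the step is deterministic: the span of \<open>D\<close> is
  at most that of \<open>d\<close>, which the increment of \<open>Q\<close> controls, and this
  restores the fourth condition.\<close>

lemma iterate_ok_Suc:
  assumes ok: "iterate_ok k y" and z: "z \<in> set_pmf (step (Suc k) y)"
    and err: "\<forall>x\<in>sa_pairs M. \<bar>table_error z x\<bar> \<le> \<epsilon>"
  shows "iterate_ok (Suc k) z"
proof -
  obtain Q T h N W where y: "y = (Q, T, h, N, W)" by (cases y)
  note ok = ok[unfolded y]
  define Q' where "Q' x = (1 - \<beta> (Suc k)) * Q0 x + \<beta> (Suc k) * T x" for x
  define d where "d s = max_act M Q' s - h s" for s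
  define m where "m = sample_size (Suc k) d"
  from z obtain D where D: "D \<in> set_pmf (SAMPLE M d m)"
    and z: "z = (Q', \<lambda>x. T x + D x, max_act M Q', N + table_size * m, W + table_size * m + table_size)"
    unfolding y savia_step_def Let_def prod.case m_def sample_size_def table_size_def d_def Q'_def
    by auto
  have m: "0 < m" unfolding m_def by (rule sample_size_pos)
  have h: "h = max_act M Q" using ok by (simp add: iterate_ok_def)
  have d: "sp (states M) d \<le> increment_bound (Suc k)"
    unfolding d_def h
    using order_trans[OF sp_max_act_diff_le sp_next_iterate_minus_iterate_le[OF ok, folded Q'_def]] .
  have "sp (sa_pairs M) (\<lambda>x. \<beta> (Suc k) * (T x + D x) + (1 - \<beta> (Suc k)) * Q0 x - Q' x)
      = sp (sa_pairs M) (\<lambda>x. \<beta> (Suc k) * D x)"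
    by (simp add: Q'_def algebra_simps)
  also have "\<dots> \<le> \<beta> (Suc k) * sp (sa_pairs M) D"
    by (intro sp_scale_le finite_pairs pairs_nonempty \<beta>_nonneg)
  also have "\<dots> \<le> \<beta> (Suc k) * increment_bound (Suc k)"
    using sp_SAMPLE_le[OF D m] d by (intro mult_left_mono \<beta>_nonneg) simp
  finally have incr: "sp (sa_pairs M) (\<lambda>x. \<beta> (Suc k) * (T x + D x) + (1 - \<beta> (Suc k)) * Q0 x - Q' x)
      \<le> \<beta> (Suc k) * increment_bound (Suc k)" .
  have "real m \<le> \<alpha> * c (Suc k) * (sp (states M) d)\<^sup>2 / \<epsilon>\<^sup>2 + 1"
    unfolding m_def by (rule sample_size_le)
  also have "\<dots> \<le> \<alpha> * c (Suc k) * (increment_bound (Suc k))\<^sup>2 / \<epsilon>\<^sup>2 + 1"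
    using \<alpha>_pos c_pos[of "Suc k"] sp_nonneg[OF finite_states states_nonempty, of d] d
    by (intro add_right_mono divide_right_mono mult_left_mono power_mono) auto
  finally have "real N + real table_size * real m
      \<le> real table_size * sample_bound k
        + real table_size * (\<alpha> * c (Suc k) * (increment_bound (Suc k))\<^sup>2 / \<epsilon>\<^sup>2 + 1)"
    using ok by (intro add_mono mult_left_mono) (auto simp: iterate_ok_def)
  also have "\<dots> = real table_size * sample_bound (Suc k)"
    by (simp add: sample_bound_def distrib_left)
  finally have samples: "real (N + table_size * m) \<le> real table_size * sample_bound (Suc k)"
    by simp
  \<comment> \<open>Every iteration draws at least one sample per pair, which later lets the
    arithmetic be charged to the samples.\<close>
  have "table_size * Suc k + table_size * 1 \<le> N + table_size * m"
    using ok m by (intro add_mono mult_left_mono) (auto simp: iterate_ok_def)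
  moreover have "sp (sa_pairs M) (\<lambda>x. Q' x - Qs x) \<le> \<mu> + 2 * \<epsilon> * real (Suc k) / 3"
    unfolding Q'_def by (rule sp_next_iterate_minus_solution_le[OF ok])
  ultimately show ?thesis
    using ok err incr samples unfolding z iterate_ok_def by (simp add: algebra_simps)
qed

text \<open>A failure after iteration \<open>n + 1\<close> is either inherited or visible in the new
  table error: from a good configuration \<open>?C - ?B\<close> is impossible. Each iteration
  therefore adds one union bound over pairs and signs.\<close>

lemma prob_not_iterate_ok:
  "measure (iter (Suc n)) {z. \<not> iterate_ok n z}
    \<le> (real n + 1) * (2 * real table_size * exp (- \<alpha>))"
proof (induction n)
  case 0
  let ?B = "{z. \<exists>x\<in>sa_pairs M. \<epsilon> < \<bar>table_error z x\<bar>}"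
  have "measure (iter (Suc 0)) {z. \<not> iterate_ok 0 z} \<le> measure (iter (Suc 0)) ?B"
  proof (rule measure_pmf.finite_measure_mono_AE)
    show "AE z in iter (Suc 0). z \<in> {z. \<not> iterate_ok 0 z} \<longrightarrow> z \<in> ?B"
      using iterate_ok_0 by (force simp: AE_measure_pmf_iff bind_return_pmf not_less)
  qed auto
  then show ?case using prob_table_error_gt[of "Suc 0"] by (simp add: table_size_def)
next
  case (Suc n)
  let ?B = "{z. \<exists>x\<in>sa_pairs M. \<epsilon> < \<bar>table_error z x\<bar>}"
  let ?C = "{z. \<not> iterate_ok (Suc n) z}"
  have "measure (iter (Suc (Suc n))) ?C
      \<le> measure (iter (Suc (Suc n))) (?C - ?B) + measure (iter (Suc (Suc n))) ?B"
    by (rule order_trans[OF measure_pmf.finite_measure_mono measure_Un_le]) auto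
  moreover have "measure (iter (Suc (Suc n))) (?C - ?B) \<le> measure (iter (Suc n)) (- {z. iterate_ok n z}) + 0"
    unfolding savia_iter.simps(2)[of _ _ _ _ _ _ "Suc n"]
  proof (rule measure_bind_pmf_le)
    fix y assume "y \<in> {z. iterate_ok n z}"
    then have "set_pmf (step (Suc n) y) \<inter> (?C - ?B) = {}"
      using iterate_ok_Suc[of n y] by (force simp: not_less)
    then have "measure (step (Suc n) y) (?C - ?B) = 0"
      by (simp only: measure_pmf_zero_iff)
    then show "measure (step (Suc n) y) (?C - ?B) \<le> 0" by simp
  qed simp
  moreover have "- {z. iterate_ok n z} = {z. \<not> iterate_ok n z}" by auto
  ultimately show ?case
    using Suc.IH prob_table_error_gt[of "Suc (Suc n)"] by (simp add: table_size_def algebra_simps)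
qed

end


section \<open>One complete run of SAVIA\<close>

context anchored_savia
begin

definition run_ok :: "(('s \<times> 'a \<Rightarrow> real) \<Rightarrow> 's \<Rightarrow> 'a) \<Rightarrow> nat \<Rightarrow> ('s, 'a) result \<Rightarrow> bool" where
  "run_ok sel n = (\<lambda>(Q, T, \<pi>, N, W). \<pi> = sel Q \<and>
     sp (sa_pairs M) (\<lambda>x. Q x - T x) \<le> 8 * \<mu> / (real n + 2) + 3 * \<epsilon> \<and>
     sp (sa_pairs M) (\<lambda>x. T x - bellman M Q x) \<le> 2 * \<epsilon> \<and>
     real N \<le> real table_size * sample_bound n \<and> W \<le> 3 * N)"

lemma prob_not_run_ok:
  assumes \<delta>: "0 < \<delta>" and \<alpha>: "\<alpha> = ln (2 * real table_size * (real n + 1) / \<delta>)"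
  shows "measure (SAVIA M c \<beta> sel Q0 n \<epsilon> \<delta>) {r. \<not> run_ok sel n r} \<le> \<delta>"
proof -
  have size: "0 < table_size"
    using finite_states states_nonempty finite_actions actions_nonempty
    by (simp add: table_size_def card_gt_0_iff)
  let ?f = "\<lambda>(Q, T, h, N, W). (Q, T, sel Q, N, W + table_size)"
  have "\<beta> (0 := 0) = \<beta>" by (rule fun_upd_idem) (simp add: \<beta>_eq)
  then have "SAVIA M c \<beta> sel Q0 n \<epsilon> \<delta> = map_pmf ?f (iter (Suc n))"
    by (simp only: SAVIA_def Let_def \<alpha> table_size_def)
  then have "measure (SAVIA M c \<beta> sel Q0 n \<epsilon> \<delta>) {r. \<not> run_ok sel n r}
      = measure (iter (Suc n)) (?f -` {r. \<not> run_ok sel n r})"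
    by (simp del: savia_iter.simps)
  also have "\<dots> \<le> measure (iter (Suc n)) {z. \<not> iterate_ok n z}"
  proof (rule measure_pmf.finite_measure_mono)
    show "?f -` {r. \<not> run_ok sel n r} \<subseteq> {z. \<not> iterate_ok n z}"
    proof safe
      fix Q T h N W
      assume ok: "iterate_ok n (Q, T, h, N, W)" and bad: "\<not> run_ok sel n (Q, T, sel Q, N, W + table_size)"
      \<comment> \<open>The samples, the arithmetic of the iterations and the final pass cost at
        most \<open>N\<close> each.\<close>
      have "W + table_size \<le> 3 * N"
        using ok by (simp add: iterate_ok_def)
      with sp_iterate_minus_table_le[OF ok] sp_table_minus_bellman_le[OF ok] ok bad show False
        by (simp add: run_ok_def iterate_ok_def)
    qed
  qed simp
  also have "\<dots> \<le> (real n + 1) * (2 * real table_size * exp (- \<alpha>))"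
    by (rule prob_not_iterate_ok)
  \<comment> \<open>\<open>\<alpha>\<close> is the logarithm for which the union bound over
    \<open>n + 1\<close> iterations, all pairs and two signs is exactly
    \<open>\<delta>\<close>.\<close>
  also have "exp (- \<alpha>) = \<delta> / (2 * real table_size * (real n + 1))"
    using \<delta> size by (simp add: \<alpha> exp_minus)
  also have "(real n + 1) * (2 * real table_size * (\<delta> / (2 * real table_size * (real n + 1)))) = \<delta>"
  proof -
    define w where "w = 2 * real table_size * (real n + 1)"
    have "(real n + 1) * (2 * real table_size * (\<delta> / w)) = w * \<delta> / w"
      by (simp add: w_def)
    also have "\<dots> = \<delta>" using size by (simp add: w_def)
    finally show ?thesis by (simp only: w_def)
  qed
  finally show ?thesis .
qed

end


section \<open>The restarted algorithm\<close>

text \<open>Induction on the loops left before \<open>I\<close>, where a good run must stop, so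
  finitely many unfoldings of the recursion suffice. A run that never stops yields
  \<open>None\<close>, which belongs to the complement measured here; termination is thus part of
  the bound.\<close>

lemma savia_plus_from_prob:
  assumes run: "\<And>i. i \<le> I \<Longrightarrow> measure (SAVIA M c \<beta> sel Q0 (2 ^ i) \<epsilon> (\<delta> / c i)) (- G i) \<le> \<eta> i"
    and \<eta>: "\<And>i. 0 \<le> \<eta> i"
    and cost: "\<And>i Q T \<pi> N W. i \<le> I \<Longrightarrow> (Q, T, \<pi>, N, W) \<in> G i \<Longrightarrow> real N \<le> b \<and> real W \<le> 3 * b"
    and good: "\<And>i Q T \<pi> N W. i \<le> I \<Longrightarrow> (Q, T, \<pi>, N, W) \<in> G i \<Longrightarrow>
      sp (sa_pairs M) (\<lambda>x. Q x - T x) \<le> 14 * \<epsilon> \<Longrightarrow> good Q T \<pi>"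
    and stop: "\<And>Q T \<pi> N W. (Q, T, \<pi>, N, W) \<in> G I \<Longrightarrow> sp (sa_pairs M) (\<lambda>x. Q x - T x) \<le> 14 * \<epsilon>"
    and b: "0 \<le> b" and i: "i \<le> I"
  shows "measure (measure_pmf (savia_plus_from M c \<beta> sel Q0 \<epsilon> \<delta> i N W))
      (- Some ` {(Q, T, \<pi>, N', W'). good Q T \<pi> \<and> real N' \<le> real N + real (Suc I - i) * b \<and>
        real W' \<le> real W + real (Suc I - i) * (3 * b)}) \<le> (\<Sum>j=i..I. \<eta> j)"
  using i
proof (induction "I - i" arbitrary: i N W rule: less_induct)
  case less
  define S where "S i N W = Some ` {(Q, T, \<pi>, N', W'). good Q T \<pi> \<and>
    real N' \<le> real N + real (Suc I - i) * b \<and> real W' \<le> real W + real (Suc I - i) * (3 * b)}"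
    for i N W
  have "measure (measure_pmf (savia_plus_from M c \<beta> sel Q0 \<epsilon> \<delta> i N W)) (- S i N W)
      \<le> measure (SAVIA M c \<beta> sel Q0 (2 ^ i) \<epsilon> (\<delta> / c i)) (- G i) + (\<Sum>j=Suc i..I. \<eta> j)"
  proof (subst savia_plus_from.simps, rule measure_bind_pmf_le)
    show "0 \<le> (\<Sum>j=Suc i..I. \<eta> j)" by (intro sum_nonneg \<eta>)
  next
    fix r assume "r \<in> G i"
    obtain Q T \<pi> N' W' where r: "r = (Q, T, \<pi>, N', W')" by (cases r)
    note G = \<open>r \<in> G i\<close>[unfolded r]
    note costs = cost[OF less.prems G]
    let ?stop = "sp (sa_pairs M) (\<lambda>x. Q x - T x) \<le> 14 * \<epsilon>"
    have loops: "real (Suc I - i) = 1 + real (I - i)" using less.prems by simp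
    have "measure (measure_pmf (if ?stop then return_spmf (Q, T, \<pi>, N + N', W + W')
        else savia_plus_from M c \<beta> sel Q0 \<epsilon> \<delta> (Suc i) (N + N') (W + W'))) (- S i N W)
      \<le> (\<Sum>j=Suc i..I. \<eta> j)"
    proof (cases ?stop)
      case True
      have "0 \<le> real (I - i) * b" "0 \<le> real (I - i) * (3 * b)" using b by simp_all
      then have "Some (Q, T, \<pi>, N + N', W + W') \<in> S i N W"
        using good[OF less.prems G True] costs unfolding S_def loops
        unfolding of_nat_add distrib_right
        by (intro imageI CollectI case_prodI conjI) linarith+
      then show ?thesis using True \<eta> by (simp add: sum_nonneg)
    next
      case False
      then have "i \<noteq> I" using stop G by blast
      with less.prems have i: "I - Suc i < I - i" "Suc i \<le> I" by auto
      \<comment> \<open>The finished loop has used at most one share \<open>b\<close> of the budget,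
        and one share fewer remains.\<close>
      have "S (Suc i) (N + N') (W + W') \<subseteq> S i N W"
        using costs unfolding S_def loops by (auto simp: distrib_right)
      then have "measure (measure_pmf (savia_plus_from M c \<beta> sel Q0 \<epsilon> \<delta> (Suc i) (N + N') (W + W'))) (- S i N W)
        \<le> measure (measure_pmf (savia_plus_from M c \<beta> sel Q0 \<epsilon> \<delta> (Suc i) (N + N') (W + W')))
            (- S (Suc i) (N + N') (W + W'))"
        by (intro measure_pmf.finite_measure_mono) auto
      also have "\<dots> \<le> (\<Sum>j=Suc i..I. \<eta> j)"
        unfolding S_def by (rule less.hyps[OF i])
      finally show ?thesis using False by simp
    qed
    then show "measure (measure_pmf (case r of (Q, T, \<pi>, N', W') \<Rightarrow>
        if sp (sa_pairs M) (\<lambda>x. Q x - T x) \<le> 14 * \<epsilon> then return_spmf (Q, T, \<pi>, N + N', W + W')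
        else savia_plus_from M c \<beta> sel Q0 \<epsilon> \<delta> (Suc i) (N + N') (W + W'))) (- S i N W)
      \<le> (\<Sum>j=Suc i..I. \<eta> j)"
      by (simp add: r)
  qed
  also have "\<dots> \<le> (\<Sum>j=i..I. \<eta> j)"
    using run[OF less.prems] less.prems by (simp add: sum.atLeast_Suc_atMost)
  finally show ?case unfolding S_def .
qed

lemma measure_spmf_ge_compl:
  "measure (measure_pmf p) (- Some ` S) \<le> \<delta> \<Longrightarrow> 1 - \<delta> \<le> measure (measure_spmf p) S"
  using measure_pmf.prob_compl[of "Some ` S" p]
  by (simp add: measure_measure_spmf_conv_measure_pmf Compl_eq_Diff_UNIV)


section \<open>The parameters of the algorithm and the sample complexity\<close>

definition anchored_c :: "nat \<Rightarrow> real" where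
  "anchored_c k = 5 * (real k + 2) * (ln (real k + 2))\<^sup>2"

lemma anchored_c_ge: "40 / 9 \<le> anchored_c k"
proof -
  have "2 / 3 \<le> ln (2::real)" by (rule ln2_ge_two_thirds)
  also have "\<dots> \<le> ln (real k + 2)" by (intro ln_mono) auto
  finally have "(2 / 3)\<^sup>2 \<le> (ln (real k + 2))\<^sup>2" by (intro power_mono) auto
  then have "10 * (2 / 3)\<^sup>2 \<le> 5 * (real k + 2) * (ln (real k + 2))\<^sup>2"
    by (intro mult_mono) auto
  then show ?thesis by (simp add: anchored_c_def power2_eq_square)
qed

text \<open>A discrete form of the fact that \<open>- 1 / ln x\<close> is an antiderivative of
  \<open>1 / (x * (ln x)\<^sup>2)\<close>; the right-hand side telescopes.\<close>

lemma inverse_anchored_c_Suc_le: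
  "1 / anchored_c (Suc k) \<le> 1 / 5 * (1 / ln (real k + 2) - 1 / ln (real k + 3))"
proof -
  define u v where "u = ln (real k + 2)" and "v = ln (real k + 3)"
  have uv: "0 < u" "u \<le> v" by (simp_all add: u_def v_def)
  have "ln ((real k + 2) / (real k + 3)) \<le> (real k + 2) / (real k + 3) - 1"
    by (rule ln_le_minus_one) simp
  then have "1 / (real k + 3) \<le> v - u"
    by (simp add: u_def v_def ln_div field_simps)
  then have "1 / (real k + 3) / (v * v) \<le> (v - u) / (u * v)"
    using uv by (intro frac_le mult_right_mono) auto
  also have "\<dots> = 1 / u - 1 / v" using uv by (simp add: field_simps)
  finally have "1 / (real k + 3) / (v * v) \<le> 1 / u - 1 / v" .
  moreover have "1 / anchored_c (Suc k) = 1 / 5 * (1 / (real k + 3) / (v * v))"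
    by (simp add: anchored_c_def v_def power2_eq_square add.commute)
  ultimately show ?thesis by (simp add: u_def v_def)
qed

lemma sum_inverse_anchored_c: "(\<Sum>i<k. 1 / anchored_c i) \<le> 1"
proof -
  have ln2: "1 / ln (2::real) \<le> 3 / 2"
    using ln2_ge_two_thirds by (simp add: field_simps)
  \<comment> \<open>The first summand is bounded by \<open>9 / 40\<close>, and the others telescope
    down from \<open>1 / ln 2 \<le> 3 / 2\<close>.\<close>
  have "(\<Sum>i<Suc k. 1 / anchored_c i) \<le> 9 / 40 + 1 / 5 * (3 / 2 - 1 / ln (real k + 2))"
  proof (induction k)
    case 0
    have "1 / anchored_c 0 \<le> 9 / 40"
      using anchored_c_ge[of 0] by (subst divide_le_eq) auto
    moreover have "a \<le> 9 / 40 + 1 / 5 * (3 / 2 - b)" if "a \<le> 9 / 40" "b \<le> 3 / 2" for a b :: real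
      using that by (simp add: algebra_simps)
    ultimately show ?case
      using ln2 by (simp only: sum.lessThan_Suc lessThan_0 sum.empty add_0 of_nat_0)
  next
    case (Suc k)
    have "real (Suc k) + 2 = real k + 3" by simp
    then show ?case
      using Suc inverse_anchored_c_Suc_le[of k] by (simp add: algebra_simps)
  qed
  also have "\<dots> \<le> 1"
  proof -
    have "9 / 40 + 1 / 5 * (3 / 2 - a) \<le> 1" if "0 \<le> a" for a :: real
      using that by (simp add: algebra_simps)
    then show ?thesis by simp
  qed
  finally have "(\<Sum>i<Suc k. 1 / anchored_c i) \<le> 1" .
  moreover have "0 \<le> 1 / anchored_c k" using anchored_c_ge[of k] by simp
  ultimately show ?thesis unfolding sum.lessThan_Suc by linarith
qed

section \<open>The number of samples and the number of loops\<close>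

lemma sum_inverse_Suc_le_ln: "(\<Sum>k=1..n. 1 / (real k + 1)) \<le> ln (real n + 1)"
proof (induction n)
  case (Suc n)
  have "ln ((real n + 1) / (real n + 2)) \<le> (real n + 1) / (real n + 2) - 1"
    by (rule ln_le_minus_one) simp
  then have "1 / (real n + 2) \<le> ln (real n + 2) - ln (real n + 1)"
    by (simp add: ln_div field_simps)
  then show ?case using Suc by (simp add: add.commute)
qed simp

text \<open>In units of \<open>\<epsilon>\<close>: \<open>x\<close> stands for
  \<open>\<mu> / \<epsilon>\<close>, \<open>y\<close> for \<open>\<nu> / \<epsilon>\<close> and
  \<open>q\<close> for the span of \<open>Q0\<close>. In the squared increments the part with
  \<open>x\<close> meets a \<open>c\<^sub>k\<close> of order \<open>k\<close> up to logarithms and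
  leaves a harmonic sum, hence a third logarithm; the constant part gives
  \<open>n\<^sup>2\<close>.\<close>

lemma sample_sum_le:
  fixes \<alpha> x y :: real
  assumes \<alpha>: "0 \<le> \<alpha>" and n: "1 \<le> n" and y: "q\<^sup>2 / \<epsilon>\<^sup>2 \<le> y\<^sup>2" and \<epsilon>: "0 < \<epsilon>"
  shows "(\<Sum>k\<le>n. \<alpha> * anchored_c k * (if k = 0 then q else 4 * (x * \<epsilon>) / (real k + 1) + 2 * \<epsilon> / 3)\<^sup>2 / \<epsilon>\<^sup>2 + 1)
    \<le> (real n + 1)
      + \<alpha> * (10 * y\<^sup>2 + (ln (real n + 2))\<^sup>2 * (320 * x\<^sup>2 * ln (real n + 2) + 15 * (real n)\<^sup>2))"
proof -
  define \<Lambda> where "\<Lambda> = ln (real n + 2)"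
  have \<Lambda>: "0 < \<Lambda>" by (simp add: \<Lambda>_def)
  let ?E = "\<lambda>k. 4 * (x * \<epsilon>) / (real k + 1) + 2 * \<epsilon> / 3"
  have first: "anchored_c 0 * q\<^sup>2 / \<epsilon>\<^sup>2 \<le> 10 * y\<^sup>2"
  proof -
    have "(ln 2 :: real)\<^sup>2 \<le> 1\<^sup>2" using ln2_le_25_over_36 by (intro power_mono) auto
    then have "anchored_c 0 * (q\<^sup>2 / \<epsilon>\<^sup>2) \<le> 10 * y\<^sup>2"
      using y by (intro mult_mono) (simp_all add: anchored_c_def)
    then show ?thesis by simp
  qed
  have later: "anchored_c k * (?E k)\<^sup>2 / \<epsilon>\<^sup>2
      \<le> \<Lambda>\<^sup>2 * (320 * x\<^sup>2 * (1 / (real k + 1)) + 5 * (real n + 2))" if k: "k \<in> {1..n}" for k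
  proof -
    have "(ln (real k + 2))\<^sup>2 \<le> \<Lambda>\<^sup>2"
      unfolding \<Lambda>_def using k by (intro power_mono ln_mono) auto
    then have c: "anchored_c k \<le> 5 * (real k + 2) * \<Lambda>\<^sup>2"
      unfolding anchored_c_def by (intro mult_left_mono) auto
    have "(?E k)\<^sup>2 / \<epsilon>\<^sup>2 = (4 * x / (real k + 1) + 2 / 3)\<^sup>2"
    proof -
      have "?E k = \<epsilon> * (4 * x / (real k + 1) + 2 / 3)" by (simp add: algebra_simps)
      then show ?thesis using \<epsilon> by (simp add: power_mult_distrib)
    qed
    also have "\<dots> \<le> 2 * (4 * x / (real k + 1))\<^sup>2 + 2 * (2 / 3)\<^sup>2"
      using sum_squares_bound[of "4 * x / (real k + 1)" "2 / 3"] by (simp add: power2_sum)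
    also have "\<dots> = 32 * x\<^sup>2 * (1 / (real k + 1))\<^sup>2 + 8 / 9"
      by (simp add: power_divide power_mult_distrib)
    finally have "anchored_c k * ((?E k)\<^sup>2 / \<epsilon>\<^sup>2)
        \<le> (5 * (real k + 2) * \<Lambda>\<^sup>2) * (32 * x\<^sup>2 * (1 / (real k + 1))\<^sup>2 + 8 / 9)"
      using c by (intro mult_mono) auto
    also have "\<dots> = \<Lambda>\<^sup>2 * (160 * x\<^sup>2 * ((real k + 2) / (real k + 1) * (1 / (real k + 1))) + 40 / 9 * (real k + 2))"
      by (simp add: algebra_simps power2_eq_square)
    \<comment> \<open>The ratio \<open>(k + 2) / (k + 1) \<le> 2\<close> turns
      \<open>160 = 5 * 32\<close> into \<open>320\<close>, and \<open>40 / 9 = 5 * 8 / 9\<close> is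
      rounded up to \<open>5\<close>.\<close>
    also have "\<dots> \<le> \<Lambda>\<^sup>2 * (160 * x\<^sup>2 * (2 * (1 / (real k + 1))) + 5 * (real n + 2))"
    proof (intro mult_left_mono add_mono)
      show "(real k + 2) / (real k + 1) * (1 / (real k + 1)) \<le> 2 * (1 / (real k + 1))"
        by (intro mult_right_mono) (auto simp: field_simps)
      show "40 / 9 * (real k + 2) \<le> 5 * (real n + 2)"
        using k by (intro mult_mono) auto
    qed auto
    finally show ?thesis by simp
  qed
  have "(\<Sum>k\<le>n. anchored_c k * (if k = 0 then q else ?E k)\<^sup>2 / \<epsilon>\<^sup>2)
      = anchored_c 0 * q\<^sup>2 / \<epsilon>\<^sup>2 + (\<Sum>k=1..n. anchored_c k * (?E k)\<^sup>2 / \<epsilon>\<^sup>2)"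
  proof -
    have "{..n} = insert 0 {1..n}" by auto
    then show ?thesis by simp
  qed
  also have "\<dots> \<le> 10 * y\<^sup>2 + (\<Sum>k=1..n. \<Lambda>\<^sup>2 * (320 * x\<^sup>2 * (1 / (real k + 1)) + 5 * (real n + 2)))"
    by (intro add_mono first sum_mono later)
  also have "(\<Sum>k=1..n. \<Lambda>\<^sup>2 * (320 * x\<^sup>2 * (1 / (real k + 1)) + 5 * (real n + 2)))
      = \<Lambda>\<^sup>2 * (320 * x\<^sup>2 * (\<Sum>k=1..n. 1 / (real k + 1)) + 5 * (real n * (real n + 2)))"
    by (simp only: sum_distrib_left[symmetric] sum.distrib) (simp add: algebra_simps)
  also have "\<dots> \<le> \<Lambda>\<^sup>2 * (320 * x\<^sup>2 * \<Lambda> + 15 * (real n)\<^sup>2)"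
  proof (intro mult_left_mono add_mono)
    have "ln (real n + 1) \<le> \<Lambda>" unfolding \<Lambda>_def by (intro ln_mono) auto
    then show "(\<Sum>k=1..n. 1 / (real k + 1)) \<le> \<Lambda>"
      using sum_inverse_Suc_le_ln[of n] by linarith
    have "real n * (real n + 2) \<le> real n * (3 * real n)"
      using n by (intro mult_left_mono) auto
    then show "5 * (real n * (real n + 2)) \<le> 15 * (real n)\<^sup>2"
      by (simp add: power2_eq_square)
  qed auto
  finally have sum: "(\<Sum>k\<le>n. anchored_c k * (if k = 0 then q else ?E k)\<^sup>2 / \<epsilon>\<^sup>2)
      \<le> 10 * y\<^sup>2 + \<Lambda>\<^sup>2 * (320 * x\<^sup>2 * \<Lambda> + 15 * (real n)\<^sup>2)"
    by simp
  have "(\<Sum>k\<le>n. \<alpha> * anchored_c k * (if k = 0 then q else ?E k)\<^sup>2 / \<epsilon>\<^sup>2 + 1)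
      = (real n + 1) + \<alpha> * (\<Sum>k\<le>n. anchored_c k * (if k = 0 then q else ?E k)\<^sup>2 / \<epsilon>\<^sup>2)"
    by (simp add: sum.distrib sum_distrib_left mult.assoc)
  then show ?thesis using mult_left_mono[OF sum \<alpha>] by (simp add: \<Lambda>_def)
qed

lemma ln1_ge_1: "1 \<le> ln1 x" and ln_le_ln1: "ln x \<le> ln1 x"
  by (simp_all add: ln1_def)

lemma ln_iterations_le:
  assumes "0 \<le> x" "real n \<le> 2 * (1 + x)"
  shows "ln (real n + 2) \<le> 3 * ln1 (1 + x)"
proof -
  have "ln (real n + 2) \<le> ln (2 * (2 * (1 + x)))"
    using assms by (intro ln_mono) auto
  also have "\<dots> = ln 2 + ln (2 * (1 + x))" by (rule ln_mult_pos) (use assms in auto)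
  also have "ln (2 * (1 + x)) = ln 2 + ln (1 + x)" by (rule ln_mult_pos) (use assms in auto)
  also have "ln 2 + (ln 2 + ln (1 + x)) \<le> 3 * ln1 (1 + x)"
    using ln2_le_25_over_36 ln1_ge_1[of "1 + x"] ln_le_ln1[of "1 + x"] by linarith
  finally show ?thesis .
qed

text \<open>With \<open>n = 2 ^ i\<close>, \<open>anchored_c i\<close> is at most
  \<open>10 * n ^ 3\<close>, so the argument of the logarithm grows at most like
  \<open>n ^ 4\<close>. Raising \<open>e / \<delta> \<ge> 1\<close> to the fourth power too compares
  it with \<open>2 ^ 10 * z ^ 4\<close>, whence \<open>14 = 10 + 4\<close>.\<close>

lemma ln_confidence_le:
  assumes x: "0 \<le> x" and n: "2 ^ i \<le> 2 * (1 + x)" and e: "1 \<le> (e::real)" and \<delta>: "0 < \<delta>" "\<delta> < 1"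
  shows "ln (2 * e * (2 ^ i + 1) / (\<delta> / anchored_c i)) \<le> 14 * ln1 (e * (1 + x) / \<delta>)"
proof -
  define n :: real where "n = 2 ^ i"
  define z where "z = e * (1 + x) / \<delta>"
  have n1: "1 \<le> n" by (simp add: n_def)
  have "Suc i \<le> 2 ^ i" by (induction i) auto
  then have i: "real i + 1 \<le> n"
    unfolding n_def by (metis of_nat_Suc of_nat_le_iff of_nat_numeral of_nat_power add.commute)
  have "ln (real i + 2) \<le> real i + 1" using ln_le_minus_one[of "real i + 2"] by simp
  with i have "(ln (real i + 2))\<^sup>2 \<le> n\<^sup>2" by (intro power_mono) auto
  moreover have "5 * (real i + 2) \<le> 10 * n" using i n1 by simp
  ultimately have c: "anchored_c i \<le> (10 * n) * n\<^sup>2"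
    unfolding anchored_c_def using n1 by (intro mult_mono[of "5 * (real i + 2)"]) auto
  have z: "e / \<delta> \<le> (e / \<delta>) ^ 4"
    using e \<delta> by (intro self_le_power) (auto simp: field_simps)
  have "2 * e * (n + 1) / (\<delta> / anchored_c i) = 2 * (n + 1) * (e / \<delta>) * anchored_c i"
    using \<delta> by (simp add: field_simps)
  also have "\<dots> \<le> 2 * (2 * n) * ((e / \<delta>) ^ 4) * ((10 * n) * n\<^sup>2)"
    using e \<delta> z n1 c anchored_c_ge[of i] by (intro mult_mono) auto
  also have "\<dots> = 40 * n ^ 4 * (e / \<delta>) ^ 4"
    by (simp add: power2_eq_square power4_eq_xxxx)
  also have "\<dots> \<le> 40 * (2 * (1 + x)) ^ 4 * (e / \<delta>) ^ 4"
    using n n1 e \<delta> by (intro mult_mono power_mono) (auto simp: n_def)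
  also have "\<dots> = 640 * z ^ 4"
    unfolding z_def power_mult_distrib power_divide by simp
  also have "\<dots> \<le> 2 ^ 10 * z ^ 4"
    using x e \<delta> by (intro mult_right_mono) (auto simp: z_def)
  finally have le: "2 * e * (n + 1) / (\<delta> / anchored_c i) \<le> 2 ^ 10 * z ^ 4" .
  have zpos: "0 < z" using x e \<delta> by (simp add: z_def)
  have pos: "0 < 2 * e * (n + 1) / (\<delta> / anchored_c i)"
    using e \<delta> n1 anchored_c_ge[of i] by simp
  have "ln (2 * e * (n + 1) / (\<delta> / anchored_c i)) \<le> ln (2 ^ 10 * z ^ 4)"
    using le pos by (intro ln_mono) auto
  also have "\<dots> = 10 * ln 2 + 4 * ln z"
    using zpos by (subst ln_mult) (simp_all add: ln_realpow del: power_numeral)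
  also have "\<dots> \<le> 14 * ln1 z"
    using ln2_le_25_over_36 ln1_ge_1[of z] ln_le_ln1[of z] by linarith
  finally show ?thesis by (simp add: n_def z_def)
qed

text \<open>As \<open>n\<close> is of order \<open>1 + x\<close>, its square is absorbed by
  \<open>y\<^sup>2 + 1\<close>. The cube of \<open>l\<close> bounds
  \<open>\<Lambda>\<^sup>2 * \<Lambda>\<close>, and \<open>136220 + 16\<close> is rounded up to
  \<open>150000\<close>.\<close>

lemma loop_samples_le:
  fixes \<alpha> x y A \<Lambda> l n :: real
  assumes x: "0 \<le> x" "x \<le> y" and n: "1 \<le> n" "n \<le> 2 * (1 + x)" and \<alpha>: "0 \<le> \<alpha>" "\<alpha> \<le> 14 * A"
    and \<Lambda>: "0 \<le> \<Lambda>" "\<Lambda> \<le> 3 * l" and A: "1 \<le> A" and l: "1 \<le> l"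
  shows "(n + 1) + \<alpha> * (10 * y\<^sup>2 + \<Lambda>\<^sup>2 * (320 * x\<^sup>2 * \<Lambda> + 15 * n\<^sup>2))
    \<le> 150000 * (A * l ^ 3 * (y\<^sup>2 + 1))"
proof -
  define Y where "Y = y\<^sup>2 + 1"
  have Y: "1 \<le> Y" "y\<^sup>2 \<le> Y" by (simp_all add: Y_def)
  have xy: "x\<^sup>2 \<le> y\<^sup>2" using x by (intro power_mono) auto
  then have xY: "x\<^sup>2 \<le> Y" using Y(2) by linarith
  have l3: "1 \<le> l ^ 3" "l\<^sup>2 \<le> l ^ 3" using l by (auto intro: one_le_power power_increasing)
  have Yl: "Y \<le> Y * l ^ 3" using mult_left_mono[OF l3(1), of Y] Y(1) by simp
  have "n\<^sup>2 \<le> (2 * (1 + x))\<^sup>2" using n by (intro power_mono) auto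
  also have "\<dots> \<le> 8 * (x\<^sup>2 + 1)"
    using sum_squares_bound[of x 1] by (simp add: power2_eq_square algebra_simps)
  also note xy
  finally have n2: "n\<^sup>2 \<le> 8 * Y" by (simp add: Y_def)
  have "n \<le> n\<^sup>2" using n by (intro self_le_power) auto
  with n n2 have n1: "n + 1 \<le> 16 * Y" by linarith
  have \<Lambda>2: "\<Lambda>\<^sup>2 \<le> 9 * l\<^sup>2" using power_mono[OF \<Lambda>(2,1), of 2] by (simp add: power_mult_distrib)
  have "320 * x\<^sup>2 * \<Lambda> + 15 * n\<^sup>2 \<le> 320 * Y * (3 * l) + 15 * (8 * Y)"
    using xY Y \<Lambda> n2 by (intro add_mono mult_mono) auto
  also have "\<dots> \<le> 1080 * (Y * l)"
    using mult_left_mono[OF l, of Y] Y by simp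
  finally have "\<Lambda>\<^sup>2 * (320 * x\<^sup>2 * \<Lambda> + 15 * n\<^sup>2) \<le> (9 * l\<^sup>2) * (1080 * (Y * l))"
    using \<Lambda> by (intro mult_mono \<Lambda>2) auto
  also have "\<dots> = 9720 * (Y * l ^ 3)" by (simp add: power2_eq_square power3_eq_cube)
  finally have "10 * y\<^sup>2 + \<Lambda>\<^sup>2 * (320 * x\<^sup>2 * \<Lambda> + 15 * n\<^sup>2) \<le> 9730 * (Y * l ^ 3)"
    using Y(2) Yl by linarith
  then have "\<alpha> * (10 * y\<^sup>2 + \<Lambda>\<^sup>2 * (320 * x\<^sup>2 * \<Lambda> + 15 * n\<^sup>2)) \<le> (14 * A) * (9730 * (Y * l ^ 3))"
    using \<alpha> \<Lambda> A Y l by (intro mult_mono) auto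
  also have "\<dots> = 136220 * (A * (Y * l ^ 3))" by simp
  finally have "\<alpha> * (10 * y\<^sup>2 + \<Lambda>\<^sup>2 * (320 * x\<^sup>2 * \<Lambda> + 15 * n\<^sup>2)) \<le> 136220 * (A * (Y * l ^ 3))" .
  moreover have "Y \<le> A * (Y * l ^ 3)"
    using mult_mono[of 1 A Y "Y * l ^ 3"] Yl A Y(1) by simp
  moreover have "A * l ^ 3 * Y = A * (Y * l ^ 3)" by simp
  ultimately show ?thesis using n1 Y unfolding Y_def[symmetric] by linarith
qed

text \<open>Take the least power of two that is at least \<open>x\<close>: minimality bounds it from
  above, and taking logarithms bounds its exponent. Loops are counted from 0, hence
  \<open>Suc I\<close>.\<close>

lemma exists_last_loop:
  assumes "0 \<le> (x::real)"
  obtains I :: nat where "x \<le> 2 ^ I" "2 ^ I \<le> 2 * (1 + x)" "real (Suc I) \<le> 4 * ln1 (1 + x)"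
proof -
  define I where "I = (LEAST I. x \<le> 2 ^ I)"
  have "\<exists>I. x < 2 ^ I" by (rule real_arch_pow) simp
  then have ex: "\<exists>I. x \<le> 2 ^ I" by (meson less_imp_le)
  have I: "x \<le> 2 ^ I" unfolding I_def using ex by (rule LeastI_ex)
  have I2: "2 ^ I \<le> 2 * (1 + x)"
  proof (cases I)
    case (Suc j)
    then have "\<not> x \<le> 2 ^ j" using not_less_Least[of j "\<lambda>I. x \<le> 2 ^ I"] by (simp add: I_def)
    then show ?thesis by (simp add: Suc)
  qed (use assms in simp)
  have "real I * ln 2 = ln (2 ^ I)" by (simp add: ln_realpow)
  also have "\<dots> \<le> ln (2 * (1 + x))" using I2 by (intro ln_mono) auto
  also have "\<dots> = ln 2 + ln (1 + x)" by (rule ln_mult_pos) (use assms in auto)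
  finally have "real I * ln 2 \<le> ln 2 + ln1 (1 + x)" using ln_le_ln1[of "1 + x"] by linarith
  moreover have "real I * (2 / 3) \<le> real I * ln 2"
    using ln2_ge_two_thirds by (intro mult_left_mono) auto
  ultimately have "real (Suc I) \<le> 4 * ln1 (1 + x)"
    using ln2_le_25_over_36 ln1_ge_1[of "1 + x"] by simp
  with I I2 show thesis using that by blast
qed


section \<open>Combining the loops\<close>

theorem theorem3p4:
  shows "\<exists>K>0. \<forall>(M :: (nat, nat) mdp) Qs Q0 (\<epsilon>::real) (\<delta>::real) sel.
    finite_mdp M \<longrightarrow> weakly_communicating M \<longrightarrow> bellman_solution M Qs \<longrightarrow>
    0 < \<epsilon> \<longrightarrow> 0 < \<delta> \<longrightarrow> \<delta> < 1 \<longrightarrow> (\<forall>Q. sel Q \<in> greedy M Q) \<longrightarrow>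
    (let \<mu> = sp (sa_pairs M) (\<lambda>x. Q0 x - Qs x);
         \<nu> = sp (sa_pairs M) (\<lambda>x. Q0 x - Qs x) + sp (sa_pairs M) Q0;
         B = L_hat M \<mu> \<epsilon> \<delta> * real (card (states M)) * real (card (actions M)) * (\<nu>\<^sup>2 / \<epsilon>\<^sup>2 + 1);
         c = (\<lambda>k. 5 * (real k + 2) * (ln (real k + 2))\<^sup>2);
         \<beta> = (\<lambda>k. real k / (real k + 2))
     in measure (measure_spmf (SAVIA_plus M c \<beta> sel Q0 \<epsilon> \<delta>))
          {(Q, T, \<pi>, N, W).
             (\<forall>s \<in> states M.
                opt_gain M - gain M \<pi> s \<le> sp (sa_pairs M) (\<lambda>x. Q x - bellman M Q x)) \<and>
             sp (sa_pairs M) (\<lambda>x. Q x - bellman M Q x) \<le> 16 * \<epsilon> \<and>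
             real N \<le> K * B \<and> real W \<le> K * B}
        \<ge> 1 - \<delta>)"
proof (rule exI[of _ 1800000], intro conjI allI impI)
  \<comment> \<open>The product of \<open>150000\<close> for one loop, \<open>4\<close> for the
    number of loops and \<open>3\<close> for time against samples.\<close>
  show "(0::real) < 1800000" by simp
next
  fix M :: "(nat, nat) mdp" and Qs Q0 and \<epsilon> \<delta> :: real and sel
  assume M: "finite_mdp M" and Qs: "bellman_solution M Qs" and \<epsilon>: "0 < \<epsilon>"
    and \<delta>: "0 < \<delta>" "\<delta> < 1" and sel: "\<forall>Q. sel Q \<in> greedy M Q"
  interpret wf_mdp M by unfold_locales (rule M)
  define \<mu> where "\<mu> = sp (sa_pairs M) (\<lambda>x. Q0 x - Qs x)"
  define \<nu> where "\<nu> = sp (sa_pairs M) (\<lambda>x. Q0 x - Qs x) + sp (sa_pairs M) Q0"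
  define e where "e = card (states M) * card (actions M)"
  define \<beta> :: "nat \<Rightarrow> real" where "\<beta> = (\<lambda>k. real k / (real k + 2))"
  define l where "l = ln1 (1 + \<mu> / \<epsilon>)"
  define A where "A = ln1 (real e * (1 + \<mu> / \<epsilon>) / \<delta>)"
  \<comment> \<open>The sample budget of one loop, uniform over all loops up to the last index
    \<open>I\<close> chosen below.\<close>
  define b where "b = real e * (150000 * (A * l ^ 3 * (\<nu>\<^sup>2 / \<epsilon>\<^sup>2 + 1)))"
  define B where "B = L_hat M \<mu> \<epsilon> \<delta> * real (card (states M)) * real (card (actions M)) * (\<nu>\<^sup>2 / \<epsilon>\<^sup>2 + 1)"
  have B: "B = A * l ^ 4 * real e * (\<nu>\<^sup>2 / \<epsilon>\<^sup>2 + 1)"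
    by (simp add: B_def L_hat_def A_def l_def e_def)
  have \<mu>0: "0 \<le> \<mu>" unfolding \<mu>_def by (rule sp_nonneg[OF finite_pairs pairs_nonempty])
  have Q0: "0 \<le> sp (sa_pairs M) Q0" by (rule sp_nonneg[OF finite_pairs pairs_nonempty])
  have x: "0 \<le> \<mu> / \<epsilon>" "\<mu> / \<epsilon> \<le> \<nu> / \<epsilon>"
    using \<mu>0 Q0 \<epsilon> by (auto simp: \<nu>_def \<mu>_def divide_right_mono)
  have e: "1 \<le> real e"
    using finite_states states_nonempty finite_actions actions_nonempty
    by (simp add: e_def card_gt_0_iff Suc_le_eq flip: of_nat_mult)
  have Al: "1 \<le> A" "1 \<le> l" by (simp_all add: A_def l_def ln1_ge_1)
  have b0: "0 \<le> b" using Al by (simp add: b_def)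
  obtain I where I: "\<mu> / \<epsilon> \<le> 2 ^ I" "2 ^ I \<le> 2 * (1 + \<mu> / \<epsilon>)" "real (Suc I) \<le> 4 * l"
    using exists_last_loop[OF x(1)] unfolding l_def by blast
  \<comment> \<open>Each loop has its own confidence level and so its own \<open>\<alpha>\<close>;
    the locale is therefore interpreted for a whole family.\<close>
  define \<alpha> where "\<alpha> i = ln (2 * real e * (2 ^ i + 1) / (\<delta> / anchored_c i))" for i
  have loop: "anchored_savia M anchored_c \<beta> \<epsilon> (\<alpha> i) Qs" for i
  proof unfold_locales
    have "\<delta> / anchored_c i < 1" using \<delta> anchored_c_ge[of i] by simp
    moreover have "(1::real) \<le> 2 ^ i" by simp
    moreover have "2 \<le> 2 * real e * (2 ^ i + 1)"
      using mult_mono[of 1 "real e" 1 "2 ^ i + 1"] e by simp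
    ultimately have "\<delta> / anchored_c i < 2 * real e * (2 ^ i + 1)" by linarith
    moreover have "0 < \<delta> / anchored_c i" using \<delta> anchored_c_ge[of i] by simp
    ultimately have "1 < 2 * real e * (2 ^ i + 1) / (\<delta> / anchored_c i)"
      by (simp only: less_divide_eq_1_pos)
    then show "0 < \<alpha> i" unfolding \<alpha>_def by (rule ln_gt_zero)
    show "0 < anchored_c k" for k using anchored_c_ge[of k] by simp
    show "(\<Sum>i<k. 1 / anchored_c i) \<le> 2" for k using sum_inverse_anchored_c[of k] by simp
  qed (use \<epsilon> Qs in \<open>auto simp: \<beta>_def\<close>)
  interpret loop: anchored_savia M anchored_c \<beta> Q0 \<epsilon> "\<alpha> i" Qs for i by (rule loop)
  note loop_defs = loop.\<mu>_def[folded \<mu>_def] loop.table_size_def[folded e_def]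
  define G where "G i = {r. loop.run_ok i sel (2 ^ i) r}" for i
  define good where "good Q T \<pi> \<longleftrightarrow>
    (\<forall>s\<in>states M. opt_gain M - gain M \<pi> s \<le> sp (sa_pairs M) (\<lambda>x. Q x - bellman M Q x)) \<and>
    sp (sa_pairs M) (\<lambda>x. Q x - bellman M Q x) \<le> 16 * \<epsilon>" for Q and T :: "nat \<times> nat \<Rightarrow> real" and \<pi>
  have run: "measure (SAVIA M anchored_c \<beta> sel Q0 (2 ^ i) \<epsilon> (\<delta> / anchored_c i)) (- G i) \<le> \<delta> / anchored_c i" for i
  proof -
    have "0 < \<delta> / anchored_c i" using \<delta> anchored_c_ge[of i] by simp
    moreover have "- G i = {r. \<not> loop.run_ok i sel (2 ^ i) r}" by (auto simp: G_def)
    ultimately show ?thesis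
      using loop.prob_not_run_ok[of "\<delta> / anchored_c i" i "2 ^ i" sel] by (simp add: \<alpha>_def loop_defs)
  qed
  have samples: "real e * loop.sample_bound i (2 ^ i) \<le> b" if "i \<le> I" for i
  proof -
    have "(2::real) ^ i \<le> 2 ^ I" using that by (intro power_increasing) auto
    with I(2) have n: "2 ^ i \<le> 2 * (1 + \<mu> / \<epsilon>)" by linarith
    have "(sp (sa_pairs M) Q0)\<^sup>2 / \<epsilon>\<^sup>2 \<le> (\<nu> / \<epsilon>)\<^sup>2"
      unfolding power_divide using Q0 \<mu>0
      by (intro divide_right_mono power_mono) (auto simp: \<nu>_def \<mu>_def)
    note sum_le = sample_sum_le[OF less_imp_le[OF loop.\<alpha>_pos[of i]] _ this \<epsilon>, of "2 ^ i" "\<mu> / \<epsilon>"]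
    have incr: "4 * (\<mu> / \<epsilon> * \<epsilon>) / (real k + 1) + 2 * \<epsilon> / 3 = loop.increment_bound k" for k
      using \<epsilon> by (simp add: loop.increment_bound_def loop_defs)
    have \<alpha>_le: "\<alpha> i \<le> 14 * A" unfolding \<alpha>_def A_def by (rule ln_confidence_le[OF x(1) n e \<delta>])
    have "loop.sample_bound i (2 ^ i) \<le> (2 ^ i + 1) + \<alpha> i * (10 * (\<nu> / \<epsilon>)\<^sup>2
        + (ln (2 ^ i + 2))\<^sup>2 * (320 * (\<mu> / \<epsilon>)\<^sup>2 * ln (2 ^ i + 2) + 15 * (2 ^ i)\<^sup>2))"
      using sum_le unfolding incr by (simp add: loop.sample_bound_def)
    also have "\<dots> \<le> 150000 * (A * l ^ 3 * ((\<nu> / \<epsilon>)\<^sup>2 + 1))"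
    proof (rule loop_samples_le[OF x])
      show "ln (2 ^ i + 2) \<le> 3 * l"
        using ln_iterations_le[of "\<mu> / \<epsilon>" "2 ^ i"] x(1) n by (simp add: l_def)
    qed (use n \<alpha>_le Al less_imp_le[OF loop.\<alpha>_pos[of i]] in auto)
    finally show ?thesis
      unfolding b_def power_divide by (intro mult_left_mono) auto
  qed
  have "measure (measure_pmf (savia_plus_from M anchored_c \<beta> sel Q0 \<epsilon> \<delta> 0 0 0))
      (- Some ` {(Q, T, \<pi>, N', W'). good Q T \<pi> \<and> real N' \<le> real 0 + real (Suc I - 0) * b \<and>
        real W' \<le> real 0 + real (Suc I - 0) * (3 * b)}) \<le> (\<Sum>j=0..I. \<delta> / anchored_c j)"
  proof (rule savia_plus_from_prob[where G = G])
    show "measure (SAVIA M anchored_c \<beta> sel Q0 (2 ^ i) \<epsilon> (\<delta> / anchored_c i)) (- G i) \<le> \<delta> / anchored_c i" for i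
      by (rule run)
    show "0 \<le> \<delta> / anchored_c i" for i using \<delta> anchored_c_ge[of i] by simp
    show "real N \<le> b \<and> real W \<le> 3 * b" if "i \<le> I" "(Q, T, \<pi>, N, W) \<in> G i" for i Q T \<pi> N W
      using that(2) samples[OF that(1)] by (auto simp: G_def loop.run_ok_def loop_defs)
    show "good Q T \<pi>" if "(Q, T, \<pi>, N, W) \<in> G i" "sp (sa_pairs M) (\<lambda>x. Q x - T x) \<le> 14 * \<epsilon>" for i Q T \<pi> N W
    proof -
      have \<pi>: "\<pi> = sel Q" and TQ: "sp (sa_pairs M) (\<lambda>x. T x - bellman M Q x) \<le> 2 * \<epsilon>"
        using that(1) by (simp_all add: G_def loop.run_ok_def)
      \<comment> \<open>\<open>14 * \<epsilon>\<close> from the stopping test and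
        \<open>2 * \<epsilon>\<close> from the table error.\<close>
      have "sp (sa_pairs M) (\<lambda>x. Q x - bellman M Q x) \<le> 16 * \<epsilon>"
        using sp_add_le[OF finite_pairs pairs_nonempty, of "\<lambda>x. Q x - T x" "\<lambda>x. T x - bellman M Q x"]
          that(2) TQ by simp
      then show ?thesis
        using opt_gain_minus_gain_le[OF Qs] sel by (simp add: good_def \<pi>)
    qed
    show "sp (sa_pairs M) (\<lambda>x. Q x - T x) \<le> 14 * \<epsilon>" if "(Q, T, \<pi>, N, W) \<in> G I" for Q T \<pi> N W
    proof -
      \<comment> \<open>In loop \<open>I\<close> the span of \<open>Q - T\<close> is thus at most
        \<open>8 * \<epsilon> + 3 * \<epsilon>\<close>, which passes the test at
        \<open>14 * \<epsilon>\<close>.\<close>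
      have "\<mu> \<le> 2 ^ I * \<epsilon>" using I(1) \<epsilon> by (simp add: field_simps)
      also have "\<dots> \<le> (2 ^ I + 2) * \<epsilon>" using \<epsilon> by (intro mult_right_mono) auto
      finally have "8 * \<mu> / (2 ^ I + 2) \<le> 8 * \<epsilon>" by (simp add: divide_le_eq add_pos_pos mult.commute)
      then show ?thesis
        using that \<epsilon> by (auto simp: G_def loop.run_ok_def loop_defs)
    qed
  qed (use b0 in auto)
  also have "\<dots> = \<delta> * (\<Sum>j<Suc I. 1 / anchored_c j)"
    by (simp add: sum_distrib_left atLeast0AtMost lessThan_Suc_atMost del: sum.lessThan_Suc)
  also have "\<dots> \<le> \<delta> * 1"
    using \<delta> by (intro mult_left_mono sum_inverse_anchored_c) auto
  finally have "1 - \<delta> \<le> measure (measure_spmf (SAVIA_plus M anchored_c \<beta> sel Q0 \<epsilon> \<delta>))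
      {(Q, T, \<pi>, N', W'). good Q T \<pi> \<and> real N' \<le> real 0 + real (Suc I - 0) * b \<and>
        real W' \<le> real 0 + real (Suc I - 0) * (3 * b)}"
    unfolding SAVIA_plus_def by (intro measure_spmf_ge_compl) simp
  also have "\<dots> \<le> measure (measure_spmf (SAVIA_plus M anchored_c \<beta> sel Q0 \<epsilon> \<delta>))
      {(Q, T, \<pi>, N, W). (\<forall>s \<in> states M.
          opt_gain M - gain M \<pi> s \<le> sp (sa_pairs M) (\<lambda>x. Q x - bellman M Q x)) \<and>
        sp (sa_pairs M) (\<lambda>x. Q x - bellman M Q x) \<le> 16 * \<epsilon> \<and>
        real N \<le> 1800000 * B \<and> real W \<le> 1800000 * B}"
  proof (intro measure_spmf.finite_measure_mono)
    \<comment> \<open>The number of loops supplies the fourth factor \<open>l\<close>.\<close>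
    have "real (Suc I) * b \<le> (4 * l) * b"
      using I(3) b0 by (intro mult_right_mono)
    also have "\<dots> = 600000 * B" by (simp add: b_def B power_Suc eval_nat_numeral)
    finally have total: "real (Suc I) * b \<le> 600000 * B" .
    have "0 \<le> B" using Al by (simp add: B)
    with total have "real N \<le> real 0 + real (Suc I - 0) * b \<Longrightarrow> real N \<le> 1800000 * B"
      "real W \<le> real 0 + real (Suc I - 0) * (3 * b) \<Longrightarrow> real W \<le> 1800000 * B" for N W
      by (simp_all only: diff_zero of_nat_0 add_0 mult.left_commute[of _ 3])
    then show "{(Q, T, \<pi>, N', W'). good Q T \<pi> \<and> real N' \<le> real 0 + real (Suc I - 0) * b \<and>
        real W' \<le> real 0 + real (Suc I - 0) * (3 * b)}
      \<subseteq> {(Q, T, \<pi>, N, W). (\<forall>s \<in> states M.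
          opt_gain M - gain M \<pi> s \<le> sp (sa_pairs M) (\<lambda>x. Q x - bellman M Q x)) \<and>
        sp (sa_pairs M) (\<lambda>x. Q x - bellman M Q x) \<le> 16 * \<epsilon> \<and>
        real N \<le> 1800000 * B \<and> real W \<le> 1800000 * B}"
      unfolding good_def by blast
  qed simp
  finally show "let \<mu> = sp (sa_pairs M) (\<lambda>x. Q0 x - Qs x);
         \<nu> = sp (sa_pairs M) (\<lambda>x. Q0 x - Qs x) + sp (sa_pairs M) Q0;
         B = L_hat M \<mu> \<epsilon> \<delta> * real (card (states M)) * real (card (actions M)) * (\<nu>\<^sup>2 / \<epsilon>\<^sup>2 + 1);
         c = (\<lambda>k. 5 * (real k + 2) * (ln (real k + 2))\<^sup>2);
         \<beta> = (\<lambda>k. real k / (real k + 2))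
     in 1 - \<delta> \<le> measure (measure_spmf (SAVIA_plus M c \<beta> sel Q0 \<epsilon> \<delta>))
          {(Q, T, \<pi>, N, W).
             (\<forall>s \<in> states M.
                opt_gain M - gain M \<pi> s \<le> sp (sa_pairs M) (\<lambda>x. Q x - bellman M Q x)) \<and>
             sp (sa_pairs M) (\<lambda>x. Q x - bellman M Q x) \<le> 16 * \<epsilon> \<and>
             real N \<le> 1800000 * B \<and> real W \<le> 1800000 * B}"
    unfolding Let_def B_def \<beta>_def \<mu>_def \<nu>_def anchored_c_def[abs_def] .
qed

end
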